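(* Let $g,h\ge 0$ be integers and let $R\cup B$ be a double chain with $|R|=3g+h$ red points and $|B|=g+3h$ blue points, in general position. Then $R\cup B$ can be $K_{1,3}$-covered.
   Context: General position: no three points collinear. A point set is a double chain if it is the disjoint union of two non-empty sets $C_1$ and $C_2$, each in convex position (convex chains), facing each other in the sense that for every $p\in C_1$ and $q\in C_2$ the segment $pq$ does not cross $conv(C_1)$ nor $conv(C_2)$ (it meets $conv(C_1)$ only at $p$ and $conv(C_2)$ only at $q$). A set $X$ of red and blue points can be $K_{1,3}$-covered if $X$ can be partitioned into subsets of size $4$, each consisting of one point (the center) of one color and three points of the other color, such that the straight-line segments joining each center to the three other points of its subset are pairwise non-crossing (no two intersect except at a common endpoint). *)

theory Defs
  imports "HOL-Analysis.Analysis" "HOL-Library.Disjoint_Sets"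
begin

definition general_position :: "(real^2) set \<Rightarrow> bool" where
  "general_position X \<longleftrightarrow>
     (\<forall>a\<in>X. \<forall>b\<in>X. \<forall>c\<in>X. a \<noteq> b \<and> a \<noteq> c \<and> b \<noteq> c \<longrightarrow> \<not> collinear {a, b, c})"

definition convex_position :: "(real^2) set \<Rightarrow> bool" where
  "convex_position C \<longleftrightarrow> (\<forall>p\<in>C. p \<notin> convex hull (C - {p}))"

definition double_chain :: "(real^2) set \<Rightarrow> bool" where
  "double_chain X \<longleftrightarrow>
     (\<exists>C1 C2. X = C1 \<union> C2 \<and> C1 \<inter> C2 = {} \<and> C1 \<noteq> {} \<and> C2 \<noteq> {} \<and>
        convex_position C1 \<and> convex_position C2 \<and>
        (\<forall>p\<in>C1. \<forall>q\<in>C2.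
           closed_segment p q \<inter> convex hull C1 = {p} \<and>
           closed_segment p q \<inter> convex hull C2 = {q}))"

definition noncrossing :: "(real^2) \<times> (real^2) \<Rightarrow> (real^2) \<times> (real^2) \<Rightarrow> bool" where
  "noncrossing e f \<longleftrightarrow>
     closed_segment (fst e) (snd e) \<inter> closed_segment (fst f) (snd f)
       \<subseteq> {fst e, snd e} \<inter> {fst f, snd f}"

text \<open>\<open>ctr S\<close> is the center of the block \<open>S\<close>; an edge is a pair (center, leaf).\<close>

definition star_edges :: "(real^2) set set \<Rightarrow> ((real^2) set \<Rightarrow> real^2) \<Rightarrow> ((real^2) \<times> (real^2)) set" where
  "star_edges P ctr = {(ctr S, x) | S x. S \<in> P \<and> x \<in> S - {ctr S}}"

definition K13_coverable :: "(real^2) set \<Rightarrow> (real^2) set \<Rightarrow> bool" where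
  "K13_coverable R B \<longleftrightarrow>
     (\<exists>P ctr. partition_on (R \<union> B) P \<and>
        (\<forall>S\<in>P. card S = 4 \<and> ctr S \<in> S \<and>
           (ctr S \<in> R \<and> S - {ctr S} \<subseteq> B \<or> ctr S \<in> B \<and> S - {ctr S} \<subseteq> R)) \<and>
        pairwise noncrossing (star_edges P ctr))"

end

theory Submission
  imports Defs
begin

text \<open>
  A star is removed such that none of its edges meets a segment between two remaining points, and
  the rest is covered by induction; the invariant is that both chains stay nonempty or that one of
  \<open>g\<close> and \<open>h\<close> is \<open>0\<close>.

  Edges within a chain never meet edges of the other chain or cross edges, so any four points that
  are consecutive in the cyclic order of a chain and coloured 3:1 can be removed. The number of red
  points changes by at most one from a window of four consecutive points to the next. Hence, if
  \<open>g, h > 0\<close> and no window is coloured 3:1, each sufficiently large chain is monochromatic or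
  has exactly two red points in every window. In the second case three consecutive points around an
  end of the chain form, together with the facing end point of the other chain, a star
  that can be removed; if both chains are monochromatic, an end point is joined to the first three
  points of the other chain. If \<open>g = 0\<close>, a window with exactly one red point is used, and when
  there is none, one chain is blue and, if it has at least four points, the other one has at least
  two red points in every window, so that it has a red point near the common end of the chains,
  which is the centre of a star there. The case \<open>h = 0\<close> is symmetric.
\<close>

section \<open>Orientation of point triples\<close>

definition orient :: "real^2 \<Rightarrow> real^2 \<Rightarrow> real^2 \<Rightarrow> real" where
  "orient a b c = (b$1 - a$1) * (c$2 - a$2) - (b$2 - a$2) * (c$1 - a$1)"

lemma orient_rotate: "orient a b c = orient b c a"
  by (simp add: orient_def algebra_simps)

lemma orient_swap_left: "orient a b c = - orient b a c"
  by (simp add: orient_def algebra_simps)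

lemma orient_swap_right: "orient a b c = - orient a c b"
  by (simp add: orient_def algebra_simps)

lemma orient_degenerate [simp]: "orient a a c = 0" "orient a b a = 0" "orient a b b = 0"
  by (simp_all add: orient_def)

lemma orient_convex_comb:
  "orient a b ((1 - u) *\<^sub>R x + u *\<^sub>R y) = (1 - u) * orient a b x + u * orient a b y"
  by (simp add: orient_def algebra_simps)

lemma orient_triangulate: "orient a b c = orient q a b + orient q b c + orient q c a"
  by (simp add: orient_def algebra_simps)

lemma orient_plucker:
  "orient x a b * orient x c d = orient x a c * orient x b d - orient x a d * orient x b c"
  by (simp add: orient_def algebra_simps)

lemma orient_cramer:
  "orient p x y *\<^sub>R (q - p) = orient p q y *\<^sub>R (x - p) + orient p x q *\<^sub>R (y - p)"
  by (simp add: orient_def vec_eq_iff forall_2 algebra_simps)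

lemma orient_barycentric:
  "orient x y z *\<^sub>R v = orient v y z *\<^sub>R x + orient v z x *\<^sub>R y + orient v x y *\<^sub>R z"
  by (simp add: orient_def vec_eq_iff forall_2 algebra_simps)

lemma collinear_if_orient_eq_0:
  assumes "orient a b c = 0"
  shows "collinear {a, b, c}"
proof -
  define u v where uv: "u = a - b" "v = c - b"
  have "u$2 * v$1 = u$1 * v$2"
    using assms by (simp add: uv orient_def algebra_simps)
  moreover have "(u \<bullet> v)\<^sup>2 + (u$1 * v$2 - u$2 * v$1)\<^sup>2 = (u \<bullet> u) * (v \<bullet> v)"
    by (simp add: inner_vec_def sum_2 power2_eq_square algebra_simps)
  ultimately have "(u \<bullet> v)\<^sup>2 = (norm u * norm v)\<^sup>2"
    by (simp add: power_mult_distrib power2_norm_eq_inner)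
  then have "\<bar>u \<bullet> v\<bar> = norm u * norm v"
    by (metis abs_ge_zero mult_nonneg_nonneg norm_ge_zero power2_abs power2_eq_imp_eq)
  then show ?thesis
    unfolding norm_cauchy_schwarz_equal uv by (subst collinear_3) (auto simp: NO_MATCH_def)
qed

lemma general_position_orient:
  assumes "general_position X" "a \<in> X" "b \<in> X" "c \<in> X" "a \<noteq> b" "a \<noteq> c" "b \<noteq> c"
  shows "orient a b c \<noteq> 0"
  using assms collinear_if_orient_eq_0 unfolding general_position_def by blast

lemma convex_halfplane: "convex {x. \<sigma> * orient a b x > 0}"
proof -
  have "{x. \<sigma> * orient a b x > 0} =
      {x. vector [- \<sigma> * (b$2 - a$2), \<sigma> * (b$1 - a$1)] \<bullet> x >
          \<sigma> * ((b$1 - a$1) * a$2 - (b$2 - a$2) * a$1)}"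
    by (simp add: orient_def inner_vec_def sum_2 algebra_simps)
  then show ?thesis
    by (simp add: convex_halfspace_gt)
qed

lemma segments_disjoint_if_same_side:
  assumes "\<sigma> * orient a b x > 0" "\<sigma> * orient a b y > 0"
  shows "closed_segment a b \<inter> closed_segment x y = {}"
proof -
  have "closed_segment x y \<subseteq> {z. \<sigma> * orient a b z > 0}"
    using assms by (intro closed_segment_subset convex_halfplane) auto
  moreover have "orient a b z = 0" if "z \<in> closed_segment a b" for z
    using that by (auto simp: in_segment orient_convex_comb)
  ultimately show ?thesis by force
qed

lemma segments_disjoint_if_opposite_sides:
  assumes "\<sigma> * orient b c a > 0" "\<sigma> * orient b c d < 0"
  shows "closed_segment a c \<inter> closed_segment b d = {}"
proof (rule ccontr)
  assume "\<not> ?thesis"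
  then obtain u v where u: "0 \<le> u" "u \<le> 1" and v: "0 \<le> v" "v \<le> 1"
    and meet: "(1 - u) *\<^sub>R a + u *\<^sub>R c = (1 - v) *\<^sub>R b + v *\<^sub>R d"
    by (auto simp: in_segment)
  have "orient b c ((1 - u) *\<^sub>R a + u *\<^sub>R c) = orient b c ((1 - v) *\<^sub>R b + v *\<^sub>R d)"
    by (simp only: meet)
  then have "(1 - u) * (\<sigma> * orient b c a) = v * (\<sigma> * orient b c d)"
    unfolding orient_convex_comb by (auto simp: mult.left_commute)
  moreover have "(1 - u) * (\<sigma> * orient b c a) \<ge> 0" "v * (\<sigma> * orient b c d) \<le> 0"
    using assms u v by (auto intro: mult_nonneg_nonneg mult_nonneg_nonpos simp del: mult.assoc)
  ultimately have "(1 - u) * (\<sigma> * orient b c a) = 0" "v * (\<sigma> * orient b c d) = 0"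
    by linarith+
  then have "u = 1" "v = 0"
    using assms by auto
  then have "c = b"
    using meet by simp
  then show False
    using assms by simp
qed

lemma weighted_mean_in_segment:
  fixes a b :: "'a::real_vector"
  assumes "0 \<le> \<alpha>" "0 \<le> \<beta>" "0 < \<alpha> + \<beta>"
  shows "(\<alpha> *\<^sub>R a + \<beta> *\<^sub>R b) /\<^sub>R (\<alpha> + \<beta>) \<in> closed_segment a b"
proof -
  have "(\<alpha> *\<^sub>R a + \<beta> *\<^sub>R b) /\<^sub>R (\<alpha> + \<beta>) =
      (\<alpha> / (\<alpha> + \<beta>)) *\<^sub>R a + (\<beta> / (\<alpha> + \<beta>)) *\<^sub>R b"
    by (simp add: scaleR_add_right divide_inverse_commute)
  moreover have "\<alpha> / (\<alpha> + \<beta>) = 1 - \<beta> / (\<alpha> + \<beta>)" "0 \<le> \<beta> / (\<alpha> + \<beta>)" "\<beta> / (\<alpha> + \<beta>) \<le> 1"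
    using assms by (simp_all add: field_simps)
  ultimately show ?thesis
    unfolding in_segment by metis
qed

lemma segments_meet:
  assumes "orient a b c < 0" "orient a b d > 0" "orient c d a > 0" "orient c d b < 0"
  shows "closed_segment a b \<inter> closed_segment c d \<noteq> {}"
proof -
  let ?ab = "(- orient c d b) *\<^sub>R a + orient c d a *\<^sub>R b"
  let ?cd = "orient a b d *\<^sub>R c + (- orient a b c) *\<^sub>R d"
  have points: "?ab = ?cd"
    and weights: "- orient c d b + orient c d a = orient a b d + - orient a b c"
    by (simp_all add: orient_def vec_eq_iff forall_2 algebra_simps)
  have "?ab /\<^sub>R (- orient c d b + orient c d a) \<in> closed_segment a b"
    using assms by (intro weighted_mean_in_segment) auto
  moreover have "?cd /\<^sub>R (orient a b d + - orient a b c) \<in> closed_segment c d"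
    using assms by (intro weighted_mean_in_segment) auto
  ultimately show ?thesis
    unfolding points weights by blast
qed

lemma in_triangle:
  assumes "orient v x y > 0" "orient v y z > 0" "orient v z x > 0"
  shows "v \<in> convex hull {x, y, z}"
proof -
  let ?D = "orient x y z"
  have D: "?D = orient v y z + orient v z x + orient v x y"
    using orient_triangulate[of x y z v] by simp
  then have pos: "?D > 0"
    using assms by linarith
  have "v = (?D *\<^sub>R v) /\<^sub>R ?D"
    using pos by simp
  also have "\<dots> = (orient v y z / ?D) *\<^sub>R x + (orient v z x / ?D) *\<^sub>R y + (orient v x y / ?D) *\<^sub>R z"
    by (simp add: orient_barycentric[of x y z v] scaleR_add_right divide_inverse_commute)
  finally have "v = (orient v y z / ?D) *\<^sub>R x + (orient v z x / ?D) *\<^sub>R y +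
      (orient v x y / ?D) *\<^sub>R z" .
  moreover have "orient v y z / ?D + orient v z x / ?D + orient v x y / ?D = 1"
    using pos D by (simp flip: add_divide_distrib)
  moreover have "orient v y z / ?D \<ge> 0" "orient v z x / ?D \<ge> 0" "orient v x y / ?D \<ge> 0"
    using assms pos by simp_all
  ultimately show ?thesis
    unfolding convex_hull_3 by blast
qed

section \<open>Angular order\<close>

definition sees :: "real \<Rightarrow> real^2 \<Rightarrow> (real^2) list \<Rightarrow> bool" where
  "sees \<sigma> p xs \<longleftrightarrow> sorted_wrt (\<lambda>x y. \<sigma> * orient p x y > 0) xs"

lemma sees_nth: "sees \<sigma> p xs \<Longrightarrow> i < j \<Longrightarrow> j < length xs \<Longrightarrow> \<sigma> * orient p (xs!i) (xs!j) > 0"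
  unfolding sees_def by (rule sorted_wrt_nth_less)

lemma sees_rev [simp]: "sees \<sigma> p (rev xs) \<longleftrightarrow> sees (- \<sigma>) p xs"
  unfolding sees_def sorted_wrt_rev by (subst orient_swap_right) simp

lemma finite_total_order_list:
  assumes "finite A" "transp_on A R" "totalp_on A R"
  obtains xs where "distinct xs" "set xs = A" "sorted_wrt R xs"
  using assms
proof (induction A arbitrary: thesis rule: finite_psubset_induct)
  case (psubset A)
  show ?case
  proof (cases "A = {}")
    case True
    then show ?thesis using psubset.prems(1)[of "[]"] by simp
  next
    case False
    then obtain x where x: "x \<in> A" "\<forall>y\<in>A. y \<noteq> x \<longrightarrow> R x y"
      using Finite_Set.bex_least_element[of A R] psubset by blast
    have "A - {x} \<subset> A" "transp_on (A - {x}) R" "totalp_on (A - {x}) R"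
      using x(1) psubset.prems(2,3) by (auto intro: transp_on_subset totalp_on_subset)
    then obtain ys where "distinct ys" "set ys = A - {x}" "sorted_wrt R ys"
      using psubset.IH by metis
    then show ?thesis
      using x by (intro psubset.prems(1)[of "x # ys"]) auto
  qed
qed

lemma angular_sort:
  assumes "finite C" and q: "q \<notin> convex hull C"
    and gp: "\<And>x y. x \<in> C \<Longrightarrow> y \<in> C \<Longrightarrow> x \<noteq> y \<Longrightarrow> orient q x y \<noteq> 0"
  obtains xs where "distinct xs" "set xs = C" "sees 1 q xs"
proof -
  have "transp_on C (\<lambda>x y. orient q x y > 0)"
  proof (rule transp_onI)
    fix x y z assume C: "x \<in> C" "y \<in> C" "z \<in> C" and pos: "orient q x y > 0" "orient q y z > 0"
    have "q \<notin> convex hull {x, y, z}"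
      using q C hull_mono[of "{x, y, z}" C convex] by blast
    then have "\<not> orient q z x > 0"
      using in_triangle pos by blast
    moreover have "x \<noteq> z"
      using pos orient_swap_right[of q x y] by auto
    ultimately show "orient q x z > 0"
      using gp[OF C(1,3)] orient_swap_right[of q x z] by linarith
  qed
  moreover have "totalp_on C (\<lambda>x y. orient q x y > 0)"
  proof (rule totalp_onI)
    fix x y assume "x \<in> C" "y \<in> C" "x \<noteq> y"
    then show "orient q x y > 0 \<or> orient q y x > 0"
      using gp[of x y] orient_swap_right[of q x y] by linarith
  qed
  ultimately obtain xs where "distinct xs" "set xs = C" "sorted_wrt (\<lambda>x y. orient q x y > 0) xs"
    by (rule finite_total_order_list[OF \<open>finite C\<close>])
  then show ?thesis
    using that by (simp add: sees_def)
qed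

definition convex_polygon :: "(real^2) list \<Rightarrow> bool" where
  "convex_polygon us \<longleftrightarrow> (\<exists>\<sigma>. \<forall>i j k. i < j \<longrightarrow> j < k \<longrightarrow> k < length us \<longrightarrow>
     \<sigma> * orient (us!i) (us!j) (us!k) > 0)"

lemma convex_polygon_chords_disjoint:
  assumes "convex_polygon us" "i < length us" "j < length us" "k < length us" "l < length us"
    and "i \<noteq> j" "k \<noteq> i" "k \<noteq> j" "l \<noteq> i" "l \<noteq> j"
    and "min i j < k \<and> k < max i j \<longleftrightarrow> min i j < l \<and> l < max i j"
  shows "closed_segment (us!i) (us!j) \<inter> closed_segment (us!k) (us!l) = {}"
  using assms
proof (induction i j rule: linorder_wlog)
  case (le i j)
  let ?o = "\<lambda>h. orient (us!i) (us!j) (us!h)"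
  obtain \<sigma> where convex: "\<sigma> * orient (us!a) (us!b) (us!c) > 0"
    if "a < b" "b < c" "c < length us" for a b c
    using le.prems(1) unfolding convex_polygon_def by blast
  have between: "- \<sigma> * ?o h > 0" if "i < h" "h < j" for h
    using convex[of i h j] that le.prems(3) orient_swap_right[of "us!i" "us!j" "us!h"] by simp
  have beyond: "\<sigma> * ?o h > 0" if "h < i \<or> j < h" "h < length us" for h
    using convex[of h i j] convex[of i j h] that le orient_rotate[of "us!h" "us!i" "us!j"] by auto
  show ?case
  proof (cases "i < k \<and> k < j")
    case True
    then have "i < l \<and> l < j"
      using le by simp
    then show ?thesis
      using True between by (intro segments_disjoint_if_same_side[of "- \<sigma>"]) simp_all
  next
    case False
    then have "k < i \<or> j < k" "l < i \<or> j < l"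
      using le by auto
    then show ?thesis
      using beyond le.prems(4,5) by (intro segments_disjoint_if_same_side[of \<sigma>]) simp_all
  qed
next
  case (sym i j)
  have "closed_segment (us!j) (us!i) \<inter> closed_segment (us!k) (us!l) = {}"
    using sym.prems by (intro sym.IH) (auto simp only: max.commute[of j] min.commute[of j])
  then show ?case
    by (simp add: closed_segment_commute)
qed

lemma convex_position_left_turn:
  assumes gp: "general_position C" and cp: "convex_position C"
    and C: "p \<in> C" "x \<in> C" "y \<in> C" "z \<in> C"
    and pos: "orient p x y > 0" "orient p y z > 0" "orient p x z > 0"
  shows "orient x y z > 0"
proof (rule ccontr)
  assume "\<not> ?thesis"
  moreover have "x \<noteq> y" "y \<noteq> z" "x \<noteq> z" "p \<noteq> y"
    using pos by auto
  ultimately have "orient x y z < 0"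
    using general_position_orient[OF gp, of x y z] C by fastforce
  then have "y \<in> convex hull {p, x, z}"
    using pos orient_rotate[of p x y] orient_rotate[of x y p] orient_swap_left[of x y z]
      orient_rotate[of p y z] by (intro in_triangle) simp_all
  moreover have "{p, x, z} \<subseteq> C - {y}"
    using C \<open>x \<noteq> y\<close> \<open>y \<noteq> z\<close> \<open>p \<noteq> y\<close> by auto
  ultimately have "y \<in> convex hull (C - {y})"
    using hull_mono by blast
  then show False
    using cp C(3) unfolding convex_position_def by blast
qed

lemma convex_position_convex_polygon:
  assumes "finite C" and gp: "general_position C" and cp: "convex_position C"
  obtains us where "distinct us" "set us = C" "convex_polygon us"
proof (cases "C = {}")
  case True
  then show ?thesis using that[of "[]"] by (simp add: convex_polygon_def)
next
  case False
  then obtain p where p: "p \<in> C" "p \<notin> convex hull (C - {p})"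
    using cp unfolding convex_position_def by blast
  obtain vs where vs: "distinct vs" "set vs = C - {p}" "sees 1 p vs"
  proof (rule angular_sort)
    show "orient p x y \<noteq> 0" if "x \<in> C - {p}" "y \<in> C - {p}" "x \<noteq> y" for x y
      using general_position_orient[OF gp p(1), of x y] that by auto
  qed (use \<open>finite C\<close> p in auto)
  have "orient ((p # vs)!i) ((p # vs)!j) ((p # vs)!k) > 0"
    if "i < j" "j < k" "k < length (p # vs)" for i j k
  proof (cases i)
    case 0
    then show ?thesis
      using that sees_nth[OF vs(3), of "j - 1" "k - 1"] by (simp add: nth_Cons')
  next
    case (Suc h)
    then have "vs!h \<in> C - {p}" "vs!(j - 1) \<in> C - {p}" "vs!(k - 1) \<in> C - {p}"
      using that by (auto simp flip: vs(2))
    then show ?thesis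
      using Suc that p(1) convex_position_left_turn[OF gp cp, of p "vs!h" "vs!(j - 1)" "vs!(k - 1)"]
        sees_nth[OF vs(3)] by (simp add: nth_Cons')
  qed
  then have "convex_polygon (p # vs)"
    unfolding convex_polygon_def by (intro exI[of _ 1]) simp
  moreover have "distinct (p # vs)" "set (p # vs) = C"
    using vs p by auto
  ultimately show ?thesis using that by blast
qed

section \<open>Hull edges\<close>

definition hull_edge :: "(real^2) set \<Rightarrow> real^2 \<Rightarrow> real^2 \<Rightarrow> bool" where
  "hull_edge X a b \<longleftrightarrow> a \<in> X \<and> b \<in> X \<and> a \<noteq> b \<and> (\<forall>x\<in>X - {a, b}. orient a b x > 0)"

lemma extreme_point_exists:
  fixes X :: "'a::euclidean_space set"
  assumes "finite X" "X \<noteq> {}"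
  obtains a where "a \<in> X" "a \<notin> convex hull (X - {a})"
proof -
  have "compact (convex hull X)"
    using assms by (simp add: finite_imp_compact_convex_hull)
  then obtain a where a: "a extreme_point_of (convex hull X)"
    using assms extreme_point_exists_convex[of "convex hull X"] by auto
  then have "convex (convex hull X - {a})"
    by (simp add: extreme_point_of_stillconvex)
  then have "convex hull (X - {a}) \<subseteq> convex hull X - {a}"
    by (intro hull_minimal) (auto intro: hull_inc)
  then show ?thesis
    using that extreme_point_of_convex_hull[OF a] by blast
qed

lemma hull_edge_from_extreme_point:
  assumes "finite X" "card X \<ge> 2" and gp: "general_position X"
    and a: "a \<in> X" "a \<notin> convex hull (X - {a})"
  obtains b where "hull_edge X a b"
proof -
  obtain us where us: "distinct us" "set us = X - {a}" "sees 1 a us"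
  proof (rule angular_sort)
    show "orient a x y \<noteq> 0" if "x \<in> X - {a}" "y \<in> X - {a}" "x \<noteq> y" for x y
      using general_position_orient[OF gp a(1), of x y] that by auto
  qed (use assms(1) a in auto)
  have "card (X - {a}) \<noteq> 0"
    using assms(1,2) a by simp
  then have "us \<noteq> []"
    unfolding us(2)[symmetric] by auto
  then obtain b ws where "us = b # ws"
    by (cases us) auto
  then have X: "insert b (set ws) = X - {a}" and left: "\<forall>x\<in>set ws. orient a b x > 0"
    using us(2,3) by (simp_all add: sees_def)
  from X have "b \<in> X" "b \<noteq> a" "X - {a, b} \<subseteq> set ws"
    by blast+
  then show ?thesis
    using a(1) left by (intro that[of b]) (auto simp: hull_edge_def)
qed

lemma hull_edge_extreme_point:
  assumes "hull_edge X a b"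
  shows "b \<notin> convex hull (X - {b})"
proof
  assume b: "b \<in> convex hull (X - {b})"
  have "convex hull (X - {a, b}) \<subseteq> {y. 1 * orient a b y > 0}"
    using assms by (intro hull_minimal convex_halfplane) (auto simp: hull_edge_def)
  then have pos: "orient a b y > 0" if "y \<in> convex hull (X - {a, b})" for y
    using that by auto
  have "a \<noteq> b" and insert_a: "X - {b} = insert a (X - {a, b})"
    using assms by (auto simp: hull_edge_def)
  show False
  proof (cases "X - {a, b} = {}")
    case True
    then show False
      using b \<open>a \<noteq> b\<close> unfolding insert_a True by simp
  next
    case False
    then obtain u y where u: "0 \<le> u" "u \<le> 1" and y: "y \<in> convex hull (X - {a, b})"
      and b_eq: "b = (1 - u) *\<^sub>R a + u *\<^sub>R y"
      using b unfolding insert_a convex_hull_insert_alt by auto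
    have "orient a b ((1 - u) *\<^sub>R a + u *\<^sub>R y) = u * orient a b y"
      by (simp add: orient_convex_comb)
    then have "u = 0"
      using pos[OF y] unfolding b_eq[symmetric] by simp
    then show False
      using b_eq \<open>a \<noteq> b\<close> by simp
  qed
qed

lemma hull_edge_successor:
  assumes "finite X" "card X \<ge> 2" "general_position X" "hull_edge X a b"
  obtains c where "hull_edge X b c"
proof -
  have "b \<in> X"
    using assms(4) by (simp add: hull_edge_def)
  then show ?thesis
    using hull_edge_from_extreme_point[OF assms(1-3) _ hull_edge_extreme_point[OF assms(4)]] that
    by blast
qed

lemma hull_edge_antisym:
  assumes "card X \<ge> 3" "hull_edge X a b"
  shows "\<not> hull_edge X b a"
proof
  assume "hull_edge X b a"
  have "card {a, b} \<le> 2"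
    by (simp add: card_insert_if)
  then have "\<not> X \<subseteq> {a, b}"
    using assms(1) card_mono[of "{a, b}" X] by force
  then obtain x where "x \<in> X - {a, b}"
    by blast
  then have "orient a b x > 0" "orient b a x > 0"
    using assms(2) \<open>hull_edge X b a\<close> by (simp_all add: hull_edge_def)
  then show False
    using orient_swap_left[of a b x] by simp
qed

section \<open>Facing chains\<close>

lemma general_position_subset: "general_position X \<Longrightarrow> Y \<subseteq> X \<Longrightarrow> general_position Y"
  unfolding general_position_def by blast

lemma convex_position_subset: "convex_position C \<Longrightarrow> D \<subseteq> C \<Longrightarrow> convex_position D"
  unfolding convex_position_def by (meson Diff_mono hull_mono order_refl subset_eq)

lemma convex_contains_ray_start:
  fixes p u v :: "'a::real_vector"
  assumes K: "convex K" "p \<in> K" "p + u \<in> K" "p + v \<in> K" and "0 \<le> \<alpha>" "0 \<le> \<beta>"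
  obtains k where "0 < k" "k \<le> 1" "p + k *\<^sub>R (\<alpha> *\<^sub>R u + \<beta> *\<^sub>R v) \<in> K"
proof -
  define k where "k = 1 / (1 + \<alpha> + \<beta>)"
  have "0 < k" "k \<le> 1" "k * (1 + \<alpha> + \<beta>) = 1"
    using assms(5,6) by (simp_all add: k_def)
  then have k: "0 < k" "k \<le> 1" "k + k * \<alpha> + k * \<beta> = 1"
    by (simp_all add: distrib_left)
  have "p + k *\<^sub>R (\<alpha> *\<^sub>R u + \<beta> *\<^sub>R v) =
      (k + k * \<alpha> + k * \<beta>) *\<^sub>R p + k *\<^sub>R (\<alpha> *\<^sub>R u + \<beta> *\<^sub>R v)"
    unfolding k(3) by simp
  also have "\<dots> = k *\<^sub>R p + (k * \<alpha>) *\<^sub>R (p + u) + (k * \<beta>) *\<^sub>R (p + v)"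
    by (simp add: algebra_simps)
  also have "\<dots> \<in> convex hull {p, p + u, p + v}"
    unfolding convex_hull_3 using assms(5,6) k
    by (intro CollectI exI[of _ k] exI[of _ "k * \<alpha>"] exI[of _ "k * \<beta>"]) simp
  also have "\<dots> \<subseteq> K"
    using K by (intro hull_minimal) auto
  finally show ?thesis
    using that k by blast
qed

locale facing_chains =
  fixes C1 C2 :: "(real^2) set"
  assumes finite_chains: "finite C1" "finite C2"
    and disjoint_chains: "C1 \<inter> C2 = {}"
    and general_chains: "general_position (C1 \<union> C2)"
    and convex_chains: "convex_position C1" "convex_position C2"
    and facing: "p \<in> C1 \<Longrightarrow> q \<in> C2 \<Longrightarrow> closed_segment p q \<inter> convex hull C1 = {p}"
      "p \<in> C1 \<Longrightarrow> q \<in> C2 \<Longrightarrow> closed_segment p q \<inter> convex hull C2 = {q}"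

sublocale facing_chains \<subseteq> swap: facing_chains C2 C1
proof
  show "general_position (C2 \<union> C1)"
    using general_chains by (simp add: Un_commute)
  show "closed_segment p q \<inter> convex hull C2 = {p}" "closed_segment p q \<inter> convex hull C1 = {q}"
    if "p \<in> C2" "q \<in> C1" for p q
    using facing[OF that(2,1)] by (simp_all add: closed_segment_commute)
qed (use finite_chains disjoint_chains convex_chains in auto)

lemma (in facing_chains) facing_subchains:
  assumes "D1 \<subseteq> C1" "D2 \<subseteq> C2"
  shows "facing_chains D1 D2"
proof
  fix p q assume pq: "p \<in> D1" "q \<in> D2"
  then have "closed_segment p q \<inter> convex hull C1 = {p}" "closed_segment p q \<inter> convex hull C2 = {q}"
    using facing assms by blast+
  moreover have "p \<in> convex hull D1" "q \<in> convex hull D2"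
    using pq by (simp_all add: hull_inc)
  moreover have "convex hull D1 \<subseteq> convex hull C1" "convex hull D2 \<subseteq> convex hull C2"
    by (intro hull_mono assms)+
  ultimately show "closed_segment p q \<inter> convex hull D1 = {p}"
    "closed_segment p q \<inter> convex hull D2 = {q}"
    by blast+
next
  show "general_position (D1 \<union> D2)"
    using general_chains by (rule general_position_subset) (use assms in blast)
qed (use assms finite_chains disjoint_chains convex_chains convex_position_subset finite_subset
    in blast)+

lemma (in facing_chains) orient_neq_0:
  assumes "a \<in> C1 \<union> C2" "b \<in> C1 \<union> C2" "c \<in> C1 \<union> C2" "a \<noteq> b" "a \<noteq> c" "b \<noteq> c"
  shows "orient a b c \<noteq> 0"
  using general_chains assms by (rule general_position_orient)

lemma (in facing_chains) chains_neq: "p \<in> C1 \<Longrightarrow> q \<in> C2 \<Longrightarrow> p \<noteq> q"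
  using disjoint_chains by blast

lemma (in facing_chains) orient_cross_neq_0: "q \<in> C2 \<Longrightarrow> x \<in> C1 \<Longrightarrow> y \<in> C1 \<Longrightarrow> x \<noteq> y \<Longrightarrow> orient q x y \<noteq> 0"
  using chains_neq by (intro orient_neq_0) auto

lemma (in facing_chains) not_in_hull:
  assumes q: "q \<in> C2"
  shows "q \<notin> convex hull C1"
proof
  assume hull: "q \<in> convex hull C1"
  then obtain p where p: "p \<in> C1"
    by fastforce
  have "q \<in> closed_segment p q \<inter> convex hull C1"
    using hull by simp
  then show False
    using facing(1)[OF p q] chains_neq[OF p q] by simp
qed

text \<open>Since the segment from \<open>p\<close> to \<open>q\<close> leaves the hull of \<open>C1\<close> at once, \<open>q\<close> cannot lie in the angle
  at \<open>p\<close> spanned by two other points of \<open>C1\<close>.\<close>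

lemma (in facing_chains) not_in_angle:
  assumes "p \<in> C1" "x \<in> C1" "y \<in> C1" and q: "q \<in> C2" and xy: "\<sigma> * orient p x y > 0"
  shows "\<sigma> * orient p x q < 0 \<or> \<sigma> * orient p q y < 0"
proof (rule ccontr)
  assume neg: "\<not> ?thesis"
  define \<alpha> \<beta> where coeffs: "\<alpha> = \<sigma> * orient p q y / (\<sigma> * orient p x y)"
    "\<beta> = \<sigma> * orient p x q / (\<sigma> * orient p x y)"
  have nonneg: "0 \<le> \<alpha>" "0 \<le> \<beta>"
    unfolding coeffs using neg xy by (intro divide_nonneg_pos; linarith)+
  have "\<sigma> \<noteq> 0" "orient p x y \<noteq> 0"
    using xy by auto
  then have cancelled: "\<alpha> = orient p q y / orient p x y" "\<beta> = orient p x q / orient p x y"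
    by (simp_all add: coeffs)
  have "q - p = (orient p x y *\<^sub>R (q - p)) /\<^sub>R orient p x y"
    using \<open>orient p x y \<noteq> 0\<close> by simp
  also have "\<dots> = \<alpha> *\<^sub>R (x - p) + \<beta> *\<^sub>R (y - p)"
    unfolding orient_cramer[of p x y q] cancelled
    by (simp add: scaleR_add_right divide_inverse_commute)
  finally have q_eq: "q - p = \<alpha> *\<^sub>R (x - p) + \<beta> *\<^sub>R (y - p)" .
  obtain k where k: "0 < k" "k \<le> 1" and "p + k *\<^sub>R (\<alpha> *\<^sub>R (x - p) + \<beta> *\<^sub>R (y - p)) \<in> convex hull C1"
    by (rule convex_contains_ray_start[of "convex hull C1" p "x - p" "y - p", OF _ _ _ _ nonneg])
      (use assms in \<open>auto simp: hull_inc\<close>)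
  moreover have "p + k *\<^sub>R (q - p) = (1 - k) *\<^sub>R p + k *\<^sub>R q"
    by (simp add: algebra_simps)
  moreover have "(1 - k) *\<^sub>R p + k *\<^sub>R q \<in> closed_segment p q"
    unfolding in_segment using k by (intro exI[of _ k]) simp
  ultimately have "p + k *\<^sub>R (q - p) \<in> closed_segment p q \<inter> convex hull C1"
    unfolding q_eq[symmetric] by simp
  then show False
    using facing(1)[OF \<open>p \<in> C1\<close> q] k chains_neq[OF \<open>p \<in> C1\<close> q] by auto
qed

lemma (in facing_chains) seen_reversed:
  assumes "q \<in> C2" "x \<in> C1" "y \<in> C1" "z \<in> C1" and pos: "\<sigma> * orient q x y > 0" "\<sigma> * orient q y z > 0"
  shows "\<sigma> * orient x y z < 0"
proof (rule ccontr)
  assume "\<not> ?thesis"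
  moreover have "x \<noteq> y" "y \<noteq> z" "x \<noteq> z"
    using pos orient_swap_right[of q x y] by auto
  then have "orient x y z \<noteq> 0"
    using assms by (intro orient_neq_0) auto
  ultimately have "\<sigma> * orient y z x > 0"
    using pos orient_rotate[of x y z] by (simp add: mult_less_0_iff zero_less_mult_iff) linarith
  then have "\<sigma> * orient y z q < 0 \<or> \<sigma> * orient y q x < 0"
    using assms by (intro not_in_angle)
  then show False
    using pos orient_rotate[of q y z] orient_rotate[of q x y] orient_rotate[of x y q] by simp
qed

lemma (in facing_chains) seen_trans:
  assumes "q \<in> C2" "x \<in> C1" "y \<in> C1" "z \<in> C1" "\<sigma> * orient q x y > 0" "\<sigma> * orient q y z > 0"
  shows "\<sigma> * orient q x z > 0"
proof -
  have "\<sigma> * orient x y z = \<sigma> * orient q x y + \<sigma> * orient q y z - \<sigma> * orient q x z"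
    unfolding orient_triangulate[of x y z q] orient_swap_right[of q z x]
    by (simp add: algebra_simps)
  then show ?thesis
    using seen_reversed[OF assms] assms(5,6) by linarith
qed

lemma (in facing_chains) chord_cross_segment_disjoint:
  assumes x: "x \<in> C1" and "y \<in> C2" "a \<in> C1" "b \<in> C1" "x \<noteq> a" "x \<noteq> b"
  shows "closed_segment x y \<inter> closed_segment a b = {}"
proof -
  have "closed_segment a b \<subseteq> convex hull (C1 - {x})"
    using assms by (intro closed_segment_subset) (auto simp: hull_inc)
  moreover have "x \<notin> convex hull (C1 - {x})"
    using x convex_chains(1) by (simp add: convex_position_def)
  moreover have "closed_segment x y \<inter> convex hull (C1 - {x}) \<subseteq> {x}"
    using facing(1)[OF x \<open>y \<in> C2\<close>] hull_mono[of "C1 - {x}" C1 convex] by blast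
  ultimately show ?thesis
    by blast
qed

lemma (in facing_chains) no_third_point_beyond_crossing:
  assumes C1: "a \<in> C1" "b \<in> C1" "e \<in> C1" and C2: "c \<in> C2" "d \<in> C2"
    and crossing: "\<sigma> * orient a b c < 0" "\<sigma> * orient a b d > 0" "\<sigma> * orient c d b < 0"
      "\<sigma> * orient c d a > 0"
    and quadrant: "\<sigma> * orient a b e > 0" "\<sigma> * orient c d e < 0"
  shows False
proof -
  have plucker: "(\<sigma> * orient x y z) * (\<sigma> * orient x u v) =
      (\<sigma> * orient x y u) * (\<sigma> * orient x z v) -
      (\<sigma> * orient x y v) * (\<sigma> * orient x z u)" for x y z u v
    using arg_cong[OF orient_plucker[of x y z u v], of "\<lambda>r. \<sigma> * \<sigma> * r"] by (simp add: algebra_simps)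
  have at_b: "\<sigma> * orient b a c > 0" "\<sigma> * orient b a d < 0" "\<sigma> * orient b a e < 0"
    "\<sigma> * orient b c d < 0"
    using crossing quadrant orient_swap_left[of b a] orient_rotate[of b c d] by simp_all
  have at_c: "\<sigma> * orient c b d > 0" "\<sigma> * orient c b a > 0" "\<sigma> * orient c e d > 0"
    using crossing quadrant orient_swap_right[of c b d] orient_swap_right[of c e d]
      orient_rotate[of c b a] orient_swap_left[of b a c] by simp_all
  have "\<sigma> * orient b d e > 0"
    using not_in_angle[of b e a d \<sigma>] C1 C2 crossing(2) quadrant(1) orient_swap_right[of b d e]
      orient_rotate[of b e a] orient_rotate[of e a b]
      orient_rotate[of b d a] orient_rotate[of d a b]
    by auto
  then have "(\<sigma> * orient b a d) * (\<sigma> * orient b c e) > 0"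
    using plucker[of b a c d e] at_b by (smt (verit) mult_pos_pos mult_neg_neg)
  then have cbe: "\<sigma> * orient c b e > 0"
    using at_b(2) zero_less_mult_iff[of "\<sigma> * orient b a d"] orient_swap_left[of c b e] by auto
  then have "(\<sigma> * orient c b d) * (\<sigma> * orient c e a) > 0"
    using plucker[of c b e d a] crossing(4) at_c by (smt (verit) mult_pos_pos)
  then have "\<sigma> * orient c e a > 0"
    using at_c(1) by (rule zero_less_mult_pos)
  then show False
    using not_in_angle[of e a b c \<sigma>] C1 C2 quadrant(1) cbe
      orient_rotate[of c e a] orient_rotate[of e a b] orient_rotate[of e c b] by auto
qed

lemma (in facing_chains) no_third_point_at_crossing:
  assumes C1: "a \<in> C1" "b \<in> C1" "e \<in> C1" and C2: "c \<in> C2" "d \<in> C2"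
    and ab: "\<sigma> * orient a b d > 0" "\<sigma> * orient a b c < 0"
    and cd: "\<sigma> * orient c d a > 0" "\<sigma> * orient c d b < 0"
    and e: "orient a b e \<noteq> 0" "orient c d e \<noteq> 0"
  shows False
proof -
  have "\<sigma> \<noteq> 0"
    using ab by auto
  have swapped: "orient b a x = - orient a b x" "orient d c x = - orient c d x" for x
    by (rule orient_swap_left)+
  consider "\<sigma> * orient a b e > 0" "\<sigma> * orient c d e < 0"
    | "\<sigma> * orient a b e > 0" "\<sigma> * orient c d e > 0"
    | "\<sigma> * orient a b e < 0" "\<sigma> * orient c d e < 0"
    | "\<sigma> * orient a b e < 0" "\<sigma> * orient c d e > 0"
    using \<open>\<sigma> \<noteq> 0\<close> e by (metis linorder_neqE mult_eq_0_iff)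
  then show False
  proof cases
    case 1
    with ab cd show False
      using no_third_point_beyond_crossing[of a b e c d \<sigma>] C1 C2 by blast
  next
    case 2
    with ab cd show False
      using no_third_point_beyond_crossing[of b a e c d "- \<sigma>"] C1 C2 by (simp add: swapped)
  next
    case 3
    with ab cd show False
      using no_third_point_beyond_crossing[of a b e d c "- \<sigma>"] C1 C2 by (simp add: swapped)
  next
    case 4
    with ab cd show False
      using no_third_point_beyond_crossing[of b a e d c \<sigma>] C1 C2 by (simp add: swapped)
  qed
qed

lemma (in facing_chains) chords_disjoint_if_third_point:
  assumes C1: "a \<in> C1" "b \<in> C1" "e \<in> C1" and C2: "c \<in> C2" "d \<in> C2" and e: "e \<noteq> a" "e \<noteq> b"
  shows "closed_segment a b \<inter> closed_segment c d = {}"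
proof (cases "a = b \<or> c = d")
  case True
  have "closed_segment a b \<subseteq> convex hull C1" "closed_segment c d \<subseteq> convex hull C2"
    using C1 C2 by (simp_all add: closed_segment_subset hull_inc)
  then show ?thesis
    using True not_in_hull swap.not_in_hull C1 C2 by auto
next
  case False
  show ?thesis
  proof (rule ccontr)
    assume meet: "\<not> ?thesis"
    have distinct: "distinct [a, b, c, d, e]"
      using False C1 C2 e chains_neq by fastforce
    have neq_0: "orient a b c \<noteq> 0" "orient a b d \<noteq> 0" "orient c d a \<noteq> 0" "orient c d b \<noteq> 0"
      "orient a b e \<noteq> 0" "orient c d e \<noteq> 0"
      using distinct C1 C2 by (auto simp: orient_neq_0)
    have opposite: "\<not> (\<sigma> * orient a b c > 0 \<and> \<sigma> * orient a b d > 0)"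
      "\<not> (\<sigma> * orient c d a > 0 \<and> \<sigma> * orient c d b > 0)" for \<sigma>
      using meet segments_disjoint_if_same_side by blast+
    obtain \<sigma> :: real where \<sigma>: "\<sigma> = 1 \<or> \<sigma> = - 1"
      and ab: "\<sigma> * orient a b d > 0" "\<sigma> * orient a b c < 0"
      using neq_0 opposite(1)[of 1] opposite(1)[of "- 1"] that[of 1] that[of "- 1"] by fastforce
    have "orient c d a - orient c d b = orient a b d - orient a b c"
      by (simp add: orient_def algebra_simps)
    then have cd: "\<sigma> * orient c d a > 0" "\<sigma> * orient c d b < 0"
      using \<sigma> ab neq_0(3,4) opposite(2)[of 1] opposite(2)[of "- 1"] by auto
    show False
      using no_third_point_at_crossing[OF C1 C2 ab cd neq_0(5,6)] .
  qed
qed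

lemma (in facing_chains) chords_disjoint:
  assumes five: "5 \<le> card (C1 \<union> C2)" and "a \<in> C1" "b \<in> C1" "c \<in> C2" "d \<in> C2"
  shows "closed_segment a b \<inter> closed_segment c d = {}"
proof -
  have "card {a, b, c, d} \<le> 4"
    by (simp add: card_insert_if)
  then have "\<not> C1 \<union> C2 \<subseteq> {a, b, c, d}"
    using five card_mono[of "{a, b, c, d}" "C1 \<union> C2"] by force
  then consider e where "e \<in> C1" "e \<noteq> a" "e \<noteq> b" | e where "e \<in> C2" "e \<noteq> c" "e \<noteq> d"
    by blast
  then show ?thesis
  proof cases
    case 1
    then show ?thesis
      using chords_disjoint_if_third_point assms by blast
  next
    case 2
    then show ?thesis
      using swap.chords_disjoint_if_third_point[of c d e a b] assms by blast
  qed
qed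

section \<open>The order of the chains\<close>

lemma (in facing_chains) monochromatic_hull_edge:
  assumes five: "5 \<le> card (C1 \<union> C2)"
  obtains a b where "hull_edge (C1 \<union> C2) a b" "a \<in> C1 \<and> b \<in> C1 \<or> a \<in> C2 \<and> b \<in> C2"
proof -
  let ?X = "C1 \<union> C2"
  have X: "finite ?X" "card ?X \<ge> 2"
    using finite_chains five by auto
  obtain a where "a \<in> ?X" "a \<notin> convex hull (?X - {a})"
    using X by (metis card.empty extreme_point_exists not_numeral_le_zero)
  then obtain b where ab: "hull_edge ?X a b"
    using hull_edge_from_extreme_point X general_chains by blast
  obtain c where bc: "hull_edge ?X b c"
    using hull_edge_successor[OF X general_chains ab] .
  obtain d where cd: "hull_edge ?X c d"
    using hull_edge_successor[OF X general_chains bc] .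
  have members: "a \<in> ?X" "b \<in> ?X" "c \<in> ?X" "d \<in> ?X"
    using ab cd by (auto simp: hull_edge_def)
  have no_alternation: False if "a \<in> D1" "c \<in> D1" "b \<in> D2" "d \<in> D2" and D: "D1 \<union> D2 = ?X"
    and "facing_chains D1 D2" for D1 D2
  proof -
    interpret D: facing_chains D1 D2 by fact
    have neq: "a \<noteq> b" "c \<noteq> b" "c \<noteq> d" "a \<noteq> d"
      using that D.chains_neq by auto
    have "a \<noteq> c" "b \<noteq> d"
      using hull_edge_antisym[of ?X] ab bc cd five by auto
    moreover have turn: "orient x y z > 0" if "hull_edge ?X x y" "z \<in> ?X" "z \<noteq> x" "z \<noteq> y" for x y z
      using that by (simp add: hull_edge_def)
    ultimately have "orient a b c > 0" "orient a b d > 0" "orient b c d > 0" "orient c d a > 0"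
      using turn ab bc cd members neq by auto
    then have "closed_segment a c \<inter> closed_segment b d \<noteq> {}"
      using orient_swap_right[of a c b] orient_rotate[of a c d] orient_rotate[of b d a]
        orient_rotate[of d a b] orient_swap_right[of b d c] by (intro segments_meet) simp_all
    then show False
      using D.chords_disjoint[of a c b d] that(1-4) five D by simp
  qed
  show ?thesis
    using that ab bc cd members no_alternation[of C1 C2] no_alternation[of C2 C1]
      facing_chains_axioms swap.facing_chains_axioms by (auto simp: Un_commute)
qed

lemma (in facing_chains) hull_edge_seen_first:
  assumes ab: "hull_edge (C1 \<union> C2) a b" "a \<in> C1" "b \<in> C1" and "q \<in> C2" "x \<in> C1" "x \<noteq> a"
  shows "orient q a x > 0"
proof (rule ccontr)
  assume not: "\<not> ?thesis"
  have qab: "orient q a b > 0"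
    using ab \<open>q \<in> C2\<close> chains_neq[of a q] chains_neq[of b q] orient_rotate[of q a b]
    by (simp add: hull_edge_def)
  have "orient q x a > 0"
    using not orient_cross_neq_0[of q a x] assms orient_swap_right[of q a x] by force
  then have "orient x a b < 0"
    using seen_reversed[of q x a b 1] qab assms by simp
  moreover have "x \<noteq> b"
    using not qab by auto
  then have "orient a b x > 0"
    using ab assms by (simp add: hull_edge_def)
  ultimately show False
    using orient_rotate[of x a b] by simp
qed

lemma (in facing_chains) hull_edge_seen_order_indep:
  assumes ab: "hull_edge (C1 \<union> C2) a b" "a \<in> C1" "b \<in> C1" and q: "q \<in> C2" "q' \<in> C2"
    and xy: "x \<in> C1" "y \<in> C1" "orient q x y > 0"
  shows "orient q' x y > 0"
proof (cases "x = a")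
  case True
  then show ?thesis
    using hull_edge_seen_first[OF ab q(2) xy(2)] xy(3) by fastforce
next
  case False
  have first: "orient p a z > 0" if "p \<in> C2" "z \<in> C1" "z \<noteq> a" for p z
    using hull_edge_seen_first ab that by blast
  have "y \<noteq> a"
    using first[OF q(1) xy(1)] xy(3) False orient_swap_right[of q x a] by fastforce
  have "x \<noteq> y"
    using xy(3) by auto
  have "orient a x y < 0"
    using seen_reversed[of q a x y 1] first[OF q(1) xy(1) False] ab q xy by simp
  moreover have "\<not> orient q' y x > 0"
  proof
    assume "orient q' y x > 0"
    then have "orient a y x < 0"
      using seen_reversed[of q' a y x 1] first[OF q(2) xy(2) \<open>y \<noteq> a\<close>] ab q xy by simp
    then show False
      using \<open>orient a x y < 0\<close> orient_swap_right[of a x y] by simp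
  qed
  ultimately show ?thesis
    using orient_cross_neq_0[OF q(2) xy(1,2) \<open>x \<noteq> y\<close>] orient_swap_right[of q' x y] by linarith
qed

lemma (in facing_chains) common_seen_order:
  assumes ab: "hull_edge (C1 \<union> C2) a b" "a \<in> C1" "b \<in> C1" and "C2 \<noteq> {}"
  obtains us where "distinct us" "set us = C1" "\<And>q. q \<in> C2 \<Longrightarrow> sees 1 q us"
proof -
  obtain p where p: "p \<in> C2"
    using \<open>C2 \<noteq> {}\<close> by blast
  obtain us where us: "distinct us" "set us = C1" "sees 1 p us"
    using angular_sort[OF finite_chains(1) not_in_hull[OF p] orient_cross_neq_0[OF p]] .
  have "sees 1 q us" if "q \<in> C2" for q
    using us(3) unfolding sees_def
    by (rule sorted_wrt_mono_rel[rotated])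
      (use hull_edge_seen_order_indep[OF ab p that] us(2) in simp)
  then show ?thesis
    using that us by blast
qed

lemma (in facing_chains) sees_convex_polygon:
  assumes "q \<in> C2" "set us \<subseteq> C1" "sees \<sigma> q us"
  shows "convex_polygon us"
  unfolding convex_polygon_def
proof (intro exI[of _ "- \<sigma>"] allI impI)
  fix i j k assume "i < j" "j < k" "k < length us"
  then show "- \<sigma> * orient (us!i) (us!j) (us!k) > 0"
    using seen_reversed[of q "us!i" "us!j" "us!k" \<sigma>] assms sees_nth[OF assms(3)]
    by (simp add: subset_iff)
qed

text \<open>Moving from \<open>u\<close> to \<open>v\<close>, the order of three points of the opposite chain either persists or its
  last point becomes the first one.\<close>

lemma (in facing_chains) seen_order_rotates:
  assumes uv: "u \<in> C1" "v \<in> C1" "\<And>q. q \<in> C2 \<Longrightarrow> orient q u v > 0"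
    and xyz: "x \<in> C2" "y \<in> C2" "z \<in> C2" and seen: "orient u x y > 0" "orient u y z > 0"
  shows "orient v x y > 0 \<and> (orient v y z > 0 \<longleftrightarrow> orient v x z > 0)"
proof -
  have uxz: "orient u x z > 0"
    using swap.seen_trans[of u x y z 1] uv xyz seen by simp
  have xyz_neg: "orient x y z < 0"
    using swap.seen_reversed[of u x y z 1] uv xyz seen by simp
  then have perms: "orient y x z > 0" "orient z y x > 0" "orient x z y > 0" "orient z x y < 0"
    by (simp_all add: orient_def algebra_simps)
  have reversed: "orient p q r < 0" if "p \<in> C2" "q \<in> C2" "r \<in> C2" "orient v p q > 0"
    "orient v q r > 0" for p q r
    using swap.seen_reversed[of v p q r 1] uv that by simp
  have total: "orient v p q > 0 \<or> orient v q p > 0" if "p \<in> C2" "q \<in> C2" "p \<noteq> q" for p q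
    using swap.orient_cross_neq_0[OF uv(2) that] orient_swap_right[of v p q] by linarith
  have neq: "x \<noteq> y" "y \<noteq> z" "x \<noteq> z"
    using seen uxz by auto
  have vxy: "orient v x y > 0"
  proof (rule ccontr)
    assume "\<not> ?thesis"
    then have vyx: "orient v y x > 0"
      using total[of x y] xyz neq by blast
    then have "orient v y z > 0" "orient v z x > 0"
      using total[of y z] total[of x z] neq xyz perms reversed[of y x z] reversed[of z y x] by auto
    then have "orient z u x * orient z v y > 0" "orient z u y * orient z v x < 0"
      using uxz seen orient_rotate[of z u] orient_rotate[of z v] orient_swap_right[of v x z]
      by (simp_all add: mult_pos_neg)
    then have "orient z u v * orient z x y > 0"
      using orient_plucker[of z u v x y] by simp
    then show False
      using uv(3)[OF xyz(3)] perms(4) by (simp add: zero_less_mult_iff)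
  qed
  moreover have "orient v y z > 0 \<Longrightarrow> orient v x z > 0"
    using swap.seen_trans[of v x y z 1] uv xyz vxy by simp
  moreover have "orient v x z > 0 \<Longrightarrow> orient v y z > 0"
    using total[of y z] neq xyz perms reversed[of x z y] by auto
  ultimately show ?thesis
    by blast
qed

lemma (in facing_chains) seen_tail_persists:
  assumes uv: "u \<in> C1" "v \<in> C1" "\<And>q. q \<in> C2 \<Longrightarrow> orient q u v > 0"
    and C2: "x \<in> C2" "set ys \<subseteq> C2" and seen: "sees (- 1) u (x # ys)"
  shows "sees (- 1) v ys"
    and "q \<in> set ys \<Longrightarrow> orient v q x > 0 \<longleftrightarrow> orient v (hd ys) x > 0"
proof -
  have u_x: "orient u y x > 0" if "y \<in> set ys" for y
    using seen that orient_swap_right[of u y x] unfolding sees_def by simp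
  have u_ys: "sorted_wrt (\<lambda>p q. - 1 * orient u p q > 0) ys"
    using seen unfolding sees_def by simp
  have rotates: "orient v q p > 0 \<and> (orient v p x > 0 \<longleftrightarrow> orient v q x > 0)"
    if pq: "p \<in> set ys" "q \<in> set ys" and "- 1 * orient u p q > 0" for p q
  proof (rule seen_order_rotates[OF uv])
    show "orient u q p > 0"
      using that(3) orient_swap_right[of u p q] by simp
  qed (use u_x C2 pq in auto)
  from u_ys have "sorted_wrt (\<lambda>p q. - 1 * orient v p q > 0) ys"
  proof (rule sorted_wrt_mono_rel[rotated])
    show "- 1 * orient v p q > 0" if "p \<in> set ys" "q \<in> set ys" "- 1 * orient u p q > 0" for p q
      using rotates[OF that] orient_swap_right[of v p q] by simp
  qed
  then show "sees (- 1) v ys"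
    by (simp add: sees_def)
  show "orient v q x > 0 \<longleftrightarrow> orient v (hd ys) x > 0" if q: "q \<in> set ys"
  proof (cases "q = hd ys")
    case False
    obtain y zs where "ys = y # zs"
      using q by (cases ys) auto
    then show ?thesis
      using rotates[of y q] u_ys q False by simp
  qed simp
qed

lemma (in facing_chains) sees_persists_or_rotates:
  assumes uv: "u \<in> C1" "v \<in> C1" "\<And>q. q \<in> C2 \<Longrightarrow> orient q u v > 0"
    and ls: "set ls \<subseteq> C2" "sees (- 1) u ls"
  shows "sees (- 1) v ls \<or> sees (- 1) v (rotate1 ls)"
proof (cases ls)
  case (Cons x ys)
  have C2: "x \<in> C2" "set ys \<subseteq> C2"
    using ls(1) Cons by auto
  have tail: "sees (- 1) v ys" "q \<in> set ys \<Longrightarrow> orient v q x > 0 \<longleftrightarrow> orient v (hd ys) x > 0" for q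
    using seen_tail_persists[of u v x ys] uv C2 ls(2) Cons by simp_all
  show ?thesis
  proof (cases "orient v (hd ys) x > 0")
    case True
    then have "orient v x q < 0" if "q \<in> set ys" for q
      using tail(2)[OF that] orient_swap_right[of v x q] by simp
    then show ?thesis
      using tail(1) Cons by (simp add: sees_def)
  next
    case False
    have "orient v q x < 0" if q: "q \<in> set ys" for q
    proof -
      have "q \<noteq> x"
        using ls(2) q unfolding Cons sees_def by auto
      then have "orient v q x \<noteq> 0"
        using swap.orient_cross_neq_0[OF uv(2)] C2 q by blast
      then show ?thesis
        using tail(2)[OF q] False by linarith
    qed
    then show ?thesis
      using tail(1) Cons by (simp add: sees_def sorted_wrt_append)
  qed
qed (simp add: sees_def)

lemma (in facing_chains) sees_between:
  assumes C1: "u \<in> C1" "v \<in> C1" "w \<in> C1"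
    and uvw: "\<And>q. q \<in> C2 \<Longrightarrow> orient q u v > 0" "\<And>q. q \<in> C2 \<Longrightarrow> orient q v w > 0"
    and ls: "set ls \<subseteq> C2" "sees \<sigma> u ls" "sees \<sigma> w ls"
  shows "sees \<sigma> v ls"
proof -
  have "\<sigma> * orient v p q > 0"
    if p: "p \<in> C2" and pos: "\<sigma> * orient u p q > 0" "\<sigma> * orient w p q > 0" for p q
  proof -
    have "orient p u w > 0"
      using seen_trans[of p u v w 1] p C1 uvw by simp
    have rotate: "orient p x q = - orient x p q" for x
      by (rule orient_swap_left)
    have "orient p u w * orient v p q = orient p u v * orient w p q + orient u p q * orient p v w"
      using orient_plucker[of p u w v q] rotate orient_swap_right[of p w v]
      by (simp add: algebra_simps)
    then have "orient p u w * (\<sigma> * orient v p q) =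
        orient p u v * (\<sigma> * orient w p q) + (\<sigma> * orient u p q) * orient p v w"
      by algebra
    also have "\<dots> > 0"
      using pos uvw p by (simp add: add_pos_pos)
    finally show ?thesis
      using \<open>orient p u w > 0\<close> by (rule zero_less_mult_pos)
  qed
  then show ?thesis
    using ls unfolding sees_def sorted_wrt_iff_nth_less
    by (meson nth_mem order.strict_trans subsetD)
qed

text \<open>
  In the ordinary double chain \<open>s = length us\<close>. The definition of a double chain also admits
  configurations in which one chain lies inside the triangle spanned by its own end point
  \<open>ls!0\<close>, \<open>us!0\<close> and the last point of \<open>us\<close>: then \<open>ls!0\<close> is the first point of its chain
  as seen from \<open>us!i\<close> with \<open>i < s\<close>, and the last one as seen from the other \<open>us!i\<close>.
\<close>

locale ordered_chains = facing_chains +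
  fixes \<sigma> :: real and us ls :: "(real^2) list" and s :: nat
  assumes five_points: "5 \<le> card (C1 \<union> C2)"
    and us: "distinct us" "set us = C1"
    and ls: "distinct ls" "set ls = C2" "ls \<noteq> []"
    and switch: "0 < s" "s \<le> length us"
    and sees_us: "q \<in> C2 \<Longrightarrow> sees \<sigma> q us"
    and sees_ls: "i < s \<Longrightarrow> sees (- \<sigma>) (us!i) ls"
    and sees_rotated_ls: "s \<le> i \<Longrightarrow> i < length us \<Longrightarrow> sees (- \<sigma>) (us!i) (rotate1 ls)"

lemma (in facing_chains) seen_order_switch:
  assumes us: "us \<noteq> []" "set us = C1" "\<And>q. q \<in> C2 \<Longrightarrow> sees 1 q us"
    and ls: "set ls \<subseteq> C2" "sees (- 1) (us!0) ls"
  obtains s where "0 < s" "s \<le> length us" "\<forall>i<s. sees (- 1) (us!i) ls"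
    "\<forall>i. s \<le> i \<and> i < length us \<longrightarrow> sees (- 1) (us!i) (rotate1 ls)"
proof -
  have mem: "us!i \<in> C1" if "i < length us" for i
    using us(2) that nth_mem by blast
  have after: "orient q (us!i) (us!j) > 0" if "i < j" "j < length us" "q \<in> C2" for q i j
    using sees_nth[OF us(3)] that by simp
  define s where "s = (LEAST i. i = length us \<or> \<not> sees (- 1) (us!i) ls)"
  have s_le: "s \<le> length us"
    unfolding s_def by (rule Least_le) simp
  have at_s: "s = length us \<or> \<not> sees (- 1) (us!s) ls"
    unfolding s_def by (rule LeastI[of _ "length us"]) simp
  have before_s: "sees (- 1) (us!i) ls" if "i < s" for i
    using not_less_Least[OF that[unfolded s_def]] by blast
  have s_pos: "0 < s"
    using at_s ls(2) us(1) by (cases "s = 0") auto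
  have "sees (- 1) (us!i) (rotate1 ls)" if i: "s \<le> i" "i < length us" for i
  proof -
    have "\<not> sees (- 1) (us!i) ls"
    proof
      assume seen: "sees (- 1) (us!i) ls"
      then have "s < i"
        using at_s i by (cases "s = i") auto
      then have "sees (- 1) (us!s) ls"
        using i s_pos us(1)
        by (intro sees_between[of "us!0" "us!s" "us!i"] mem after) (simp_all add: ls seen)
      then show False
        using at_s \<open>s < i\<close> i by simp
    qed
    then show ?thesis
      using sees_persists_or_rotates[of "us!0" "us!i" ls] mem after s_pos i us(1) by (simp add: ls)
  qed
  then show ?thesis
    using s_pos s_le before_s by (intro that[of s]) simp_all
qed

lemma (in facing_chains) ordered_chains_if_hull_edge:
  assumes five: "5 \<le> card (C1 \<union> C2)" and "C2 \<noteq> {}"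
    and ab: "hull_edge (C1 \<union> C2) a b" "a \<in> C1" "b \<in> C1"
  obtains us ls s where "ordered_chains C1 C2 1 us ls s"
proof -
  obtain us where us: "distinct us" "set us = C1" "\<And>q. q \<in> C2 \<Longrightarrow> sees 1 q us"
    using common_seen_order[OF ab \<open>C2 \<noteq> {}\<close>] by blast
  have "us \<noteq> []"
    using us(2) ab by auto
  then have "us!0 \<in> C1"
    using us(2) nth_mem by blast
  then obtain ws where ws: "distinct ws" "set ws = C2" "sees 1 (us!0) ws"
    using angular_sort[OF finite_chains(2) swap.not_in_hull swap.orient_cross_neq_0] by blast
  then have "set (rev ws) \<subseteq> C2" "sees (- 1) (us!0) (rev ws)"
    by simp_all
  then obtain s where s: "0 < s" "s \<le> length us" "\<forall>i<s. sees (- 1) (us!i) (rev ws)"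
    "\<forall>i. s \<le> i \<and> i < length us \<longrightarrow> sees (- 1) (us!i) (rotate1 (rev ws))"
    using seen_order_switch[OF \<open>us \<noteq> []\<close> us(2), of "rev ws"] us(3) by blast
  have "ordered_chains C1 C2 1 us (rev ws) s"
    using five us ws(1,2) s \<open>C2 \<noteq> {}\<close> by unfold_locales auto
  then show ?thesis
    by (rule that)
qed

lemma (in ordered_chains) reversed_ordered_chains:
  assumes "s < length us"
  shows "ordered_chains C1 C2 (- \<sigma>) (rev us) (rev (rotate1 ls)) (length us - s)"
proof
  have "rotate1 (rev (rotate1 ls)) = rev ls"
    by (cases ls) simp_all
  then show "sees (- (- \<sigma>)) (rev us ! i) (rotate1 (rev (rotate1 ls)))"
    if "length us - s \<le> i" "i < length (rev us)" for i
    using that sees_ls[of "length us - Suc i"] by (simp add: rev_nth)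
  show "sees (- (- \<sigma>)) (rev us ! i) (rev (rotate1 ls))" if "i < length us - s" for i
    using that sees_rotated_ls[of "length us - Suc i"] by (simp add: rev_nth)
qed (use assms us ls switch five_points sees_us in simp_all)

lemma (in facing_chains) ordered_chains_exist:
  assumes five: "5 \<le> card (C1 \<union> C2)" and ne: "C1 \<noteq> {}" "C2 \<noteq> {}"
  obtains D1 D2 \<sigma> us ls s where "(D1, D2) = (C1, C2) \<or> (D1, D2) = (C2, C1)"
    "ordered_chains D1 D2 \<sigma> us ls s" "3 \<le> length us \<Longrightarrow> 2 \<le> s"
proof -
  obtain a b where ab: "hull_edge (C1 \<union> C2) a b" "a \<in> C1 \<and> b \<in> C1 \<or> a \<in> C2 \<and> b \<in> C2"
    using monochromatic_hull_edge[OF five] .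
  obtain D1 D2 us ls s where D: "(D1, D2) = (C1, C2) \<or> (D1, D2) = (C2, C1)"
    "ordered_chains D1 D2 1 us ls s"
  proof (cases "a \<in> C1 \<and> b \<in> C1")
    case True
    then obtain us ls s where "ordered_chains C1 C2 1 us ls s"
      using ordered_chains_if_hull_edge[OF five ne(2) ab(1)] by blast
    then show ?thesis
      by (intro that[of C1 C2]) simp_all
  next
    case False
    then have "hull_edge (C2 \<union> C1) a b" "a \<in> C2" "b \<in> C2" "5 \<le> card (C2 \<union> C1)"
      using ab five by (auto simp: Un_commute)
    then obtain us ls s where "ordered_chains C2 C1 1 us ls s"
      using swap.ordered_chains_if_hull_edge[OF _ ne(1)] by blast
    then show ?thesis
      by (intro that[of C2 C1]) simp_all
  qed
  interpret D: ordered_chains D1 D2 1 us ls s by fact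
  show ?thesis
  proof (cases "3 \<le> length us \<longrightarrow> 2 \<le> s")
    case True
    then show ?thesis
      by (intro that[OF D]) simp
  next
    case False
    then have "s < length us" "2 \<le> length us - s"
      by linarith+
    then show ?thesis
      by (intro that[OF D(1) D.reversed_ordered_chains])
  qed
qed

lemma (in ordered_chains) us_mem: "i < length us \<Longrightarrow> us!i \<in> C1"
  using us(2) nth_mem by blast

lemma (in ordered_chains) ls_mem: "j < length ls \<Longrightarrow> ls!j \<in> C2"
  using ls(2) nth_mem by blast

lemma (in ordered_chains) us_neq_ls: "i < length us \<Longrightarrow> j < length ls \<Longrightarrow> us!i \<noteq> ls!j"
  using chains_neq us_mem ls_mem by blast

lemma (in ordered_chains) card_chains: "card C1 = length us" "card C2 = length ls"
  using us ls distinct_card by blast+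

lemma (in ordered_chains) convex_polygons: "convex_polygon us" "convex_polygon ls"
proof -
  show "convex_polygon us"
    using sees_convex_polygon[of "ls!0" us \<sigma>] sees_us ls_mem[of 0] us(2) ls(3) by simp
  have "us \<noteq> []"
    using switch by auto
  then show "convex_polygon ls"
    using swap.sees_convex_polygon[of "us!0" ls "- \<sigma>"] sees_ls us_mem[of 0] ls(2) switch by simp
qed

lemma (in ordered_chains) us_seen_in_order:
  "q \<in> C2 \<Longrightarrow> i < j \<Longrightarrow> j < length us \<Longrightarrow> \<sigma> * orient q (us!i) (us!j) > 0"
  using sees_nth[OF sees_us] .

lemma (in ordered_chains) ls_seen_in_order:
  assumes "i < length us" "j < length ls" "k < length ls"
    and before: "0 < j \<and> j < k \<or> j = 0 \<and> 0 < k \<and> i < s \<or> k = 0 \<and> 0 < j \<and> s \<le> i"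
  shows "\<sigma> * orient (us!i) (ls!j) (ls!k) < 0"
proof (cases "i < s")
  case True
  then show ?thesis
    using sees_nth[OF sees_ls[OF True], of j k] assms by auto
next
  case False
  define k' where "k' = (if k = 0 then length ls else k) - 1"
  have "j - 1 < k'" "k' < length ls"
    using assms False by (auto simp: k'_def)
  then have "- \<sigma> * orient (us!i) (rotate1 ls ! (j - 1)) (rotate1 ls ! k') > 0"
    using assms(1) False by (intro sees_nth[OF sees_rotated_ls]) auto
  moreover have "rotate1 ls ! (j - 1) = ls!j" "rotate1 ls ! k' = ls!k"
    using assms False by (auto simp: k'_def nth_rotate1)
  ultimately show ?thesis
    by simp
qed

lemma (in ordered_chains) cross_segments_disjoint:
  assumes i: "i < i'" "i' < length us" and pq: "p \<in> C2" "q \<in> C2"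
    and "\<sigma> * orient (us!i) p q < 0 \<or> \<sigma> * orient (us!i') p q < 0"
  shows "closed_segment (us!i) p \<inter> closed_segment (us!i') q = {}"
  using assms(5)
proof
  assume "\<sigma> * orient (us!i) p q < 0"
  then have "closed_segment (us!i') q \<inter> closed_segment (us!i) p = {}"
    using us_seen_in_order[OF pq(2) i] orient_rotate[of q "us!i" "us!i'"]
      orient_swap_right[of "us!i" q "us!i'"] orient_swap_right[of "us!i" p q]
    by (intro segments_disjoint_if_opposite_sides[of "- \<sigma>"]) simp_all
  then show ?thesis
    by blast
next
  assume "\<sigma> * orient (us!i') p q < 0"
  then show ?thesis
    using us_seen_in_order[OF pq(1) i] orient_rotate[of "us!i'" p "us!i"]
    by (intro segments_disjoint_if_opposite_sides[of \<sigma>]) simp_all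
qed

definition (in ordered_chains) unblocked :: "nat set \<Rightarrow> nat set \<Rightarrow> nat \<Rightarrow> nat \<Rightarrow> bool" where
  "unblocked I J i j \<longleftrightarrow>
     (if j = 0 \<and> s \<le> i then {i..<length us} \<subseteq> I else {..i} \<subseteq> I \<and> {..j} \<subseteq> J)"

lemma (in ordered_chains) unblocked_cross_segments_disjoint:
  assumes "unblocked I J i j" and ij: "i < length us" "j \<in> J" "j < length ls"
    and kl: "k < length us" "k \<notin> I" "l < length ls" "l \<notin> J"
  shows "closed_segment (us!i) (ls!j) \<inter> closed_segment (us!k) (ls!l) = {}"
proof (cases "j = 0 \<and> s \<le> i")
  case True
  then have "{i..<length us} \<subseteq> I"
    using assms(1) by (simp add: unblocked_def)
  then have "k < i"
    using kl(1,2) by (meson atLeastLessThan_iff leI subsetD)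
  moreover have "0 < l"
    using True ij(2) kl(4) by (auto intro: gr0I)
  ultimately have "closed_segment (us!k) (ls!l) \<inter> closed_segment (us!i) (ls!j) = {}"
    using True ij kl ls_seen_in_order[of i l j] by (intro cross_segments_disjoint ls_mem) auto
  then show ?thesis
    by blast
next
  case False
  then have "{..i} \<subseteq> I" "{..j} \<subseteq> J"
    using assms(1) unfolding unblocked_def by presburger+
  then have "i < k" "j < l"
    using kl by (meson atMost_iff leI subsetD)+
  moreover from this have "\<sigma> * orient (us!i) (ls!j) (ls!l) < 0"
    using False ij kl by (intro ls_seen_in_order) auto
  ultimately show ?thesis
    using ij kl by (intro cross_segments_disjoint ls_mem) simp_all
qed

section \<open>Removable stars\<close>

definition unobstructed :: "(real^2) set \<Rightarrow> real^2 \<Rightarrow> real^2 \<Rightarrow> bool" where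
  "unobstructed Y a b \<longleftrightarrow> (\<forall>x\<in>Y. \<forall>y\<in>Y. closed_segment a b \<inter> closed_segment x y = {})"

lemma unobstructed_commute: "unobstructed Y a b \<longleftrightarrow> unobstructed Y b a"
  by (simp add: unobstructed_def closed_segment_commute)

definition separated :: "(real^2) set \<Rightarrow> (real^2) set \<Rightarrow> bool" where
  "separated T Y \<longleftrightarrow> (\<forall>a\<in>T. \<forall>b\<in>T. a \<noteq> b \<longrightarrow> unobstructed Y a b)"

definition removable_star :: "(real^2) set \<Rightarrow> (real^2) set \<Rightarrow> (real^2) set \<Rightarrow> real^2 \<Rightarrow> bool" where
  "removable_star X R S c \<longleftrightarrow> S \<subseteq> X \<and> card S = 4 \<and> c \<in> S \<and>
     (\<forall>z\<in>S - {c}. (z \<in> R) \<noteq> (c \<in> R) \<and> unobstructed (X - S) c z)"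

lemma (in facing_chains) unobstructed_chord:
  assumes five: "5 \<le> card (C1 \<union> C2)" and ab: "a \<in> S \<inter> C1" "b \<in> S \<inter> C1" "a \<noteq> b"
    and sep: "separated (S \<inter> C1) (C1 - S)"
  shows "unobstructed (C1 \<union> C2 - S) a b"
  unfolding unobstructed_def
proof (intro ballI)
  fix x y assume xy: "x \<in> C1 \<union> C2 - S" "y \<in> C1 \<union> C2 - S"
  then have neq: "x \<noteq> a" "x \<noteq> b" "y \<noteq> a" "y \<noteq> b"
    using ab by auto
  consider "x \<in> C1" "y \<in> C1" | "x \<in> C1" "y \<in> C2" | "x \<in> C2" "y \<in> C1" | "x \<in> C2" "y \<in> C2"
    using xy by blast
  then show "closed_segment a b \<inter> closed_segment x y = {}"
  proof cases
    case 1
    then show ?thesis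
      using sep ab xy by (simp add: separated_def unobstructed_def)
  next
    case 2
    then show ?thesis
      using chord_cross_segment_disjoint[of x y a b] ab neq by blast
  next
    case 3
    then show ?thesis
      using chord_cross_segment_disjoint[of y x a b] ab neq closed_segment_commute[of x y] by blast
  next
    case 4
    then show ?thesis
      using chords_disjoint[OF five] ab by blast
  qed
qed

lemma (in facing_chains) unobstructed_cross_edge:
  assumes pq: "p \<in> S \<inter> C1" "q \<in> S \<inter> C2"
    and cross: "\<And>x y. x \<in> C1 - S \<Longrightarrow> y \<in> C2 - S \<Longrightarrow> closed_segment p q \<inter> closed_segment x y = {}"
  shows "unobstructed (C1 \<union> C2 - S) p q"
  unfolding unobstructed_def
proof (intro ballI)
  fix x y assume xy: "x \<in> C1 \<union> C2 - S" "y \<in> C1 \<union> C2 - S"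
  then have neq: "p \<noteq> x" "p \<noteq> y" "q \<noteq> x" "q \<noteq> y"
    using pq by auto
  consider "x \<in> C1" "y \<in> C1" | "x \<in> C1" "y \<in> C2" | "x \<in> C2" "y \<in> C1" | "x \<in> C2" "y \<in> C2"
    using xy by blast
  then show "closed_segment p q \<inter> closed_segment x y = {}"
  proof cases
    case 1
    then show ?thesis
      using chord_cross_segment_disjoint[of p q x y] pq neq by blast
  next
    case 2
    then show ?thesis
      using cross xy by blast
  next
    case 3
    then show ?thesis
      using cross[of y x] xy by (simp add: closed_segment_commute)
  next
    case 4
    then show ?thesis
      using swap.chord_cross_segment_disjoint[of q p x y] pq neq
      by (simp add: closed_segment_commute)
  qed
qed

lemma (in facing_chains) removable_starI:
  assumes five: "5 \<le> card (C1 \<union> C2)" and S: "S \<subseteq> C1 \<union> C2" "card S = 4" "c \<in> S"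
    and sep: "separated (S \<inter> C1) (C1 - S)" "separated (S \<inter> C2) (C2 - S)"
    and colour: "\<And>z. z \<in> S \<Longrightarrow> z \<noteq> c \<Longrightarrow> (z \<in> R) \<noteq> (c \<in> R)"
    and cross: "\<And>p q x y. p \<in> S \<inter> C1 \<Longrightarrow> q \<in> S \<inter> C2 \<Longrightarrow> c = p \<or> c = q \<Longrightarrow> x \<in> C1 - S \<Longrightarrow> y \<in> C2 - S \<Longrightarrow>
      closed_segment p q \<inter> closed_segment x y = {}"
  shows "removable_star (C1 \<union> C2) R S c"
proof -
  have "unobstructed (C1 \<union> C2 - S) c z" if z: "z \<in> S" "z \<noteq> c" for z
  proof -
    consider "c \<in> C1" "z \<in> C1" | "c \<in> C2" "z \<in> C2" | "c \<in> C1" "z \<in> C2" | "c \<in> C2" "z \<in> C1"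
      using S z by blast
    then show ?thesis
    proof cases
      case 1
      then show ?thesis
        using unobstructed_chord[OF five _ _ _ sep(1)] S z by blast
    next
      case 2
      have "5 \<le> card (C2 \<union> C1)"
        using five by (simp add: Un_commute)
      then show ?thesis
        using swap.unobstructed_chord[OF _ _ _ _ sep(2), of c z] 2 S z by (simp add: Un_commute)
    next
      case 3
      then show ?thesis
        using unobstructed_cross_edge[of c S z] cross S z by blast
    next
      case 4
      then show ?thesis
        using unobstructed_cross_edge[of z S c] cross S z unobstructed_commute by blast
    qed
  qed
  then show ?thesis
    using S colour by (simp add: removable_star_def)
qed

section \<open>Cyclic windows\<close>

definition cyclic_interval :: "nat \<Rightarrow> nat set \<Rightarrow> bool" where
  "cyclic_interval m I \<longleftrightarrow> I \<subseteq> {..<m} \<and> (\<exists>lo hi. I = {lo..<hi} \<or> I = {..<m} - {lo..<hi})"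

lemma cyclic_interval_bounded: "cyclic_interval m I \<Longrightarrow> i \<in> I \<Longrightarrow> i < m"
  by (auto simp: cyclic_interval_def)

lemma cyclic_interval_lessThan: "k \<le> m \<Longrightarrow> cyclic_interval m {..<k}"
  unfolding cyclic_interval_def lessThan_atLeast0 by auto

lemma cyclic_interval_corners:
  assumes "3 \<le> m"
  shows "cyclic_interval m {0, 1, 2}" "cyclic_interval m {m - 1, 0, 1}"
    "cyclic_interval m {m - 2, m - 1, 0}"
proof -
  have "{0, 1, 2} = {..<3::nat}"
    by auto
  then show "cyclic_interval m {0, 1, 2}"
    using assms cyclic_interval_lessThan[of 3 m] by simp
  have "{m - 1, 0, 1} = {..<m} - {2..<m - 1}" "{m - 2, m - 1, 0} = {..<m} - {1..<m - 2}"
    using assms by auto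
  then show "cyclic_interval m {m - 1, 0, 1}" "cyclic_interval m {m - 2, m - 1, 0}"
    unfolding cyclic_interval_def by blast+
qed

lemma cyclic_interval_window:
  assumes "i < m" "w \<le> m"
  shows "cyclic_interval m ((\<lambda>k. (i + k) mod m) ` {..<w})"
proof (cases "i + w \<le> m")
  case True
  then have "(\<lambda>k. (i + k) mod m) ` {..<w} = (+) i ` {..<w}"
    by (intro image_cong) auto
  then show ?thesis
    using True unfolding cyclic_interval_def by (auto simp: lessThan_atLeast0 add.commute)
next
  case False
  have "(\<lambda>k. (i + k) mod m) ` {..<w} = {..<m} - {i + w - m..<i}"
  proof (intro equalityI subsetI)
    fix x assume "x \<in> (\<lambda>k. (i + k) mod m) ` {..<w}"
    then obtain k where "k < w" "x = (i + k) mod m"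
      by auto
    then show "x \<in> {..<m} - {i + w - m..<i}"
      using assms by (cases "i + k < m") (auto simp: mod_if)
  next
    fix x assume "x \<in> {..<m} - {i + w - m..<i}"
    then have x: "x < m" "x < i + w - m \<or> i \<le> x"
      by auto
    define k where "k = (if i \<le> x then x - i else x + m - i)"
    have "k < w" "(i + k) mod m = x"
      using x assms False by (auto simp: k_def)
    then show "x \<in> (\<lambda>k. (i + k) mod m) ` {..<w}"
      by blast
  qed
  then show ?thesis
    unfolding cyclic_interval_def by blast
qed

lemma inj_on_window:
  fixes i m w :: nat
  assumes "i < m" "w \<le> m"
  shows "inj_on (\<lambda>k. (i + k) mod m) {..<w}"
proof (rule inj_onI)
  have "(i + k) mod m = (if i + k < m then i + k else i + k - m)" if "k < w" for k
    using assms that by (simp add: le_mod_geq)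
  then show "x = y" if "x \<in> {..<w}" "y \<in> {..<w}" "(i + x) mod m = (i + y) mod m" for x y
    using assms that by (auto split: if_splits)
qed

lemma separated_cyclic_interval:
  assumes "convex_polygon us" and I: "cyclic_interval (length us) I"
  shows "separated ((!) us ` I) (set us - (!) us ` I)"
  unfolding separated_def unobstructed_def
proof (intro ballI impI)
  fix a b x y
  assume "a \<in> (!) us ` I" "b \<in> (!) us ` I" "a \<noteq> b"
  then obtain i j where ij: "i \<in> I" "j \<in> I" "a = us!i" "b = us!j" "i \<noteq> j"
    by blast
  assume "x \<in> set us - (!) us ` I" "y \<in> set us - (!) us ` I"
  then obtain k l where "x = us!k" "k < length us" "y = us!l" "l < length us" "us!k \<notin> (!) us ` I"
    "us!l \<notin> (!) us ` I"
    by (metis DiffE in_set_conv_nth)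
  then have kl: "k < length us" "k \<notin> I" "x = us!k" "l < length us" "l \<notin> I" "y = us!l"
    by blast+
  obtain lo hi where "I = {lo..<hi} \<or> I = {..<length us} - {lo..<hi}"
    using I unfolding cyclic_interval_def by blast
  then have "min i j < k \<and> k < max i j \<longleftrightarrow> min i j < l \<and> l < max i j"
    using ij kl by (auto simp: min_def max_def)
  moreover have "i < length us" "j < length us"
    using cyclic_interval_bounded[OF I] ij by blast+
  moreover have "k \<noteq> i" "k \<noteq> j" "l \<noteq> i" "l \<noteq> j"
    using ij kl by blast+
  ultimately show "closed_segment a b \<inter> closed_segment x y = {}"
    unfolding ij kl using kl ij by (intro convex_polygon_chords_disjoint[OF assms(1)])
qed

definition window_count :: "nat \<Rightarrow> 'a set \<Rightarrow> 'a list \<Rightarrow> nat \<Rightarrow> nat" where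
  "window_count w R xs i = (\<Sum>k<w. of_bool (xs ! ((i + k) mod length xs) \<in> R))"

lemma window_count_eq_card:
  "window_count w R xs i = card {k. k < w \<and> xs ! ((i + k) mod length xs) \<in> R}"
  by (simp add: window_count_def Int_def)

lemma window_count_le: "window_count w R xs i \<le> w"
  unfolding window_count_eq_card by (rule order_trans[OF card_mono[of "{..<w}"]]) auto

lemma sum_window_shift:
  fixes f :: "nat \<Rightarrow> 'a::comm_monoid_add"
  shows "(\<Sum>k<w. f (Suc i + k)) + f i = (\<Sum>k<w. f (i + k)) + f (i + w)"
proof -
  have "(\<Sum>k<w. f (Suc i + k)) + f i = (\<Sum>k<Suc w. f (i + k))"
    unfolding sum.lessThan_Suc_shift by (simp add: add.commute)
  then show ?thesis
    by simp
qed

lemma sum_nth_rotate: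
  fixes f :: "'a \<Rightarrow> nat"
  shows "(\<Sum>i<length xs. f (xs ! ((k + i) mod length xs))) = (\<Sum>i<length xs. f (xs ! i))"
proof (induction k)
  case (Suc k)
  show ?case
    using sum_window_shift[of "\<lambda>i. f (xs ! (i mod length xs))" k "length xs"] unfolding Suc by simp
qed simp

lemma sum_window_count:
  assumes "distinct xs"
  shows "(\<Sum>i<length xs. window_count w R xs i) = w * card (set xs \<inter> R)"
proof -
  let ?m = "length xs" and ?c = "\<lambda>x. of_bool (x \<in> R) :: nat"
  have "(\<Sum>i<?m. window_count w R xs i) = (\<Sum>k<w. \<Sum>i<?m. ?c (xs ! ((k + i) mod ?m)))"
    unfolding window_count_def by (subst sum.swap) (simp only: add.commute)
  also have "\<dots> = w * (\<Sum>i<?m. ?c (xs ! i))"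
    by (simp only: sum_nth_rotate[of ?c]) simp
  also have "(\<Sum>i<?m. ?c (xs ! i)) = (\<Sum>x\<in>set xs. ?c x)"
    by (rule sum.reindex_bij_betw[OF bij_betw_nth[OF assms]]) auto
  also have "\<dots> = card (set xs \<inter> R)"
    by (simp add: Int_def)
  finally show ?thesis .
qed

lemma window_count_Suc:
  "window_count w R xs (Suc i) \<le> window_count w R xs i + 1"
  "window_count w R xs i \<le> window_count w R xs (Suc i) + 1"
proof -
  let ?f = "\<lambda>i. of_bool (xs ! (i mod length xs) \<in> R) :: nat"
  have "window_count w R xs (Suc i) + ?f i = window_count w R xs i + ?f (i + w)"
    unfolding window_count_def by (rule sum_window_shift)
  moreover have "?f i \<le> 1" "?f (i + w) \<le> 1"
    by simp_all
  ultimately show "window_count w R xs (Suc i) \<le> window_count w R xs i + 1"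
    "window_count w R xs i \<le> window_count w R xs (Suc i) + 1"
    by linarith+
qed

lemma window_count_one_side:
  assumes "\<And>i. i < m \<Longrightarrow> window_count w R xs i \<noteq> v"
  shows "(\<forall>i<m. window_count w R xs i < v) \<or> (\<forall>i<m. window_count w R xs i > v)"
proof -
  have "window_count w R xs i < v \<longleftrightarrow> window_count w R xs 0 < v" if "i < m" for i
    using that
  proof (induction i)
    case (Suc i)
    then show ?case
      using assms[of i] assms[of "Suc i"] window_count_Suc[of w R xs i] by auto
  qed simp
  then show ?thesis
    using assms by (metis linorder_neqE_nat)
qed

lemma window_count_const:
  assumes "distinct xs" "\<And>i. i < length xs \<Longrightarrow> window_count w R xs i = v"
  shows "length xs * v = w * card (set xs \<inter> R)"
  using sum_window_count[OF assms(1), of w R] assms(2) by simp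

lemma disjoint_if_window_count_0:
  assumes "distinct xs" "0 < w" "\<forall>i<length xs. window_count w R xs i < 1"
  shows "set xs \<inter> R = {}"
proof -
  have "card (set xs \<inter> R) = 0"
    using window_count_const[OF assms(1), of w R 0] assms(2,3) by auto
  then show ?thesis
    by simp
qed

lemma subset_if_window_count_max:
  assumes "distinct xs" "0 < w" "\<forall>i<length xs. w - 1 < window_count w R xs i"
  shows "set xs \<subseteq> R"
proof -
  have "window_count w R xs i = w" if "i < length xs" for i
    using window_count_le[of w R xs i] assms(3)[rule_format, OF that] by linarith
  then have "card (set xs \<inter> R) = card (set xs)"
    using window_count_const[OF assms(1), of w R w] distinct_card[OF assms(1)] assms(2) by simp
  then have "set xs \<inter> R = set xs"
    by (intro card_subset_eq) auto
  then show ?thesis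
    by blast
qed

lemma window_count_cases:
  assumes "distinct xs"
  obtains i where "i < length xs" "window_count 4 R xs i = 1 \<or> window_count 4 R xs i = 3"
    | "set xs \<subseteq> R" | "set xs \<inter> R = {}"
    | "\<And>i. i < length xs \<Longrightarrow> window_count 4 R xs i = 2" "even (length xs)"
proof (cases "\<exists>i<length xs. window_count 4 R xs i = 1 \<or> window_count 4 R xs i = 3")
  case False
  then have "(\<forall>i<length xs. window_count 4 R xs i < 1) \<or> (\<forall>i<length xs. window_count 4 R xs i > 1)"
    "(\<forall>i<length xs. window_count 4 R xs i < 3) \<or> (\<forall>i<length xs. window_count 4 R xs i > 3)"
    by (intro window_count_one_side; blast)+
  then consider "\<forall>i<length xs. window_count 4 R xs i < 1"
    | "\<forall>i<length xs. window_count 4 R xs i > 3"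
    | "\<forall>i<length xs. 1 < window_count 4 R xs i \<and> window_count 4 R xs i < 3"
    by blast
  then show ?thesis
  proof cases
    case 1
    then show ?thesis
      using that(3) disjoint_if_window_count_0[OF assms, of 4 R] by simp
  next
    case 2
    then show ?thesis
      using that(2) subset_if_window_count_max[OF assms, of 4 R] by simp
  next
    case 3
    have two: "window_count 4 R xs i = 2" if "i < length xs" for i
      using 3[rule_format, OF that] by linarith
    then have "length xs = 2 * card (set xs \<inter> R)"
      using window_count_const[OF assms, of 4 R 2] by simp
    then show ?thesis
      using that(4) two by simp
  qed
qed (use that(1) in blast)

definition red_dense :: "'a set \<Rightarrow> 'a list \<Rightarrow> bool" where
  "red_dense R xs \<longleftrightarrow>
     length xs \<le> 2 * card (set xs \<inter> R) \<and> (\<forall>i<length xs. 2 \<le> window_count 4 R xs i)"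

lemma disjoint_or_red_dense:
  assumes "distinct xs" "\<And>i. i < length xs \<Longrightarrow> window_count 4 R xs i \<noteq> 1"
  shows "set xs \<inter> R = {} \<or> red_dense R xs"
  using window_count_one_side[OF assms(2)]
proof
  assume "\<forall>i<length xs. window_count 4 R xs i < 1"
  then show ?thesis
    using disjoint_if_window_count_0[OF assms(1), of 4 R] by simp
next
  assume dense: "\<forall>i<length xs. 1 < window_count 4 R xs i"
  then have "(\<Sum>i<length xs. 2) \<le> (\<Sum>i<length xs. window_count 4 R xs i)"
    by (intro sum_mono) auto
  then show ?thesis
    using sum_window_count[OF assms(1), of 4 R] dense by (auto simp: red_dense_def)
qed

lemma card_window_complement:
  "card {k. k < w \<and> xs ! ((i + k) mod length xs) \<notin> R} = w - window_count w R xs i"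
proof -
  let ?red = "\<lambda>k. xs ! ((i + k) mod length xs) \<in> R"
  have "{k. k < w \<and> \<not> ?red k} = {..<w} - {k. k < w \<and> ?red k}"
    by auto
  then show ?thesis
    unfolding window_count_eq_card by (simp add: card_Diff_subset subset_iff)
qed

lemma window_odd_one_out:
  assumes "window_count 4 R xs i = 1 \<or> window_count 4 R xs i = 3"
  obtains k where "k < 4" "xs ! ((i + k) mod length xs) \<in> R \<longleftrightarrow> window_count 4 R xs i = 1"
    "\<And>l. l < 4 \<Longrightarrow> l \<noteq> k \<Longrightarrow>
      (xs ! ((i + l) mod length xs) \<in> R) \<noteq> (xs ! ((i + k) mod length xs) \<in> R)"
proof -
  let ?red = "\<lambda>k. xs ! ((i + k) mod length xs) \<in> R"
  from assms show ?thesis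
  proof
    assume one: "window_count 4 R xs i = 1"
    then obtain k where "{k. k < 4 \<and> ?red k} = {k}"
      unfolding window_count_eq_card by (auto simp: card_1_singleton_iff)
    then have k: "k < 4" "?red k" and unique: "\<And>l. l < 4 \<Longrightarrow> ?red l \<Longrightarrow> l = k"
      by blast+
    show ?thesis
    proof (rule that[OF k(1)])
      show "?red k \<longleftrightarrow> window_count 4 R xs i = 1"
        using k(2) one by simp
      show "?red l \<noteq> ?red k" if "l < 4" "l \<noteq> k" for l
        using unique[OF that(1)] that(2) k(2) by blast
    qed
  next
    assume three: "window_count 4 R xs i = 3"
    then obtain k where "{k. k < 4 \<and> \<not> ?red k} = {k}"
      using card_window_complement[of 4 xs i R] by (auto simp: card_1_singleton_iff)
    then have k: "k < 4" "\<not> ?red k" and unique: "\<And>l. l < 4 \<Longrightarrow> \<not> ?red l \<Longrightarrow> l = k"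
      by blast+
    show ?thesis
    proof (rule that[OF k(1)])
      show "?red k \<longleftrightarrow> window_count 4 R xs i = 1"
        using k(2) three by simp
      show "?red l \<noteq> ?red k" if "l < 4" "l \<noteq> k" for l
        using unique[OF that(1)] that(2) k(2) by blast
    qed
  qed
qed

lemma (in facing_chains) window_star:
  assumes five: "5 \<le> card (C1 \<union> C2)"
    and us: "distinct us" "set us = C1" "convex_polygon us" "4 \<le> length us" "i < length us"
    and count: "window_count 4 R us i = 1 \<or> window_count 4 R us i = 3"
  obtains S c where "removable_star (C1 \<union> C2) R S c" "S \<subseteq> C1" "c \<in> R \<longleftrightarrow> window_count 4 R us i = 1"
proof -
  let ?w = "\<lambda>k. (i + k) mod length us"
  obtain k where k: "k < 4" "us ! ?w k \<in> R \<longleftrightarrow> window_count 4 R us i = 1"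
    and odd: "\<And>l. l < 4 \<Longrightarrow> l \<noteq> k \<Longrightarrow> (us ! ?w l \<in> R) \<noteq> (us ! ?w k \<in> R)"
    using window_odd_one_out[OF count] by blast
  define I where "I = ?w ` {..<4}"
  define S where "S = (!) us ` I"
  have I: "cyclic_interval (length us) I"
    unfolding I_def using us by (intro cyclic_interval_window)
  have "inj_on ((!) us) I"
    using us(1) by (rule inj_on_nth) (use cyclic_interval_bounded[OF I] in blast)
  then have "card S = card I"
    by (simp add: S_def card_image)
  then have card: "card S = 4"
    using inj_on_window[OF us(5,4)] by (simp add: I_def card_image)
  have "S \<subseteq> C1"
    using cyclic_interval_bounded[OF I] us(2) nth_mem by (force simp: S_def)
  then have S: "S \<inter> C1 = S" "S \<inter> C2 = {}"
    using disjoint_chains by blast+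
  have "removable_star (C1 \<union> C2) R S (us ! ?w k)"
  proof (rule removable_starI[OF five _ card])
    show "separated (S \<inter> C1) (C1 - S)"
      using separated_cyclic_interval[OF us(3) I] unfolding S(1) unfolding us(2) S_def .
    show "separated (S \<inter> C2) (C2 - S)"
      unfolding S by (simp add: separated_def)
    show "(z \<in> R) \<noteq> (us ! ?w k \<in> R)" if "z \<in> S" "z \<noteq> us ! ?w k" for z
      using that odd by (auto simp: S_def I_def)
    show "us ! ?w k \<in> S"
      using k(1) by (simp add: S_def I_def)
  qed (use \<open>S \<subseteq> C1\<close> S(2) in auto)
  then show ?thesis
    using that \<open>S \<subseteq> C1\<close> k(2) by blast
qed

section \<open>Stars at the common end of the chains\<close>

definition (in ordered_chains) corner :: "nat set \<Rightarrow> nat set \<Rightarrow> (real^2) set" where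
  "corner I J = (!) us ` I \<union> (!) ls ` J"

lemma (in ordered_chains) corner_Int:
  assumes "I \<subseteq> {..<length us}" "J \<subseteq> {..<length ls}"
  shows "corner I J \<inter> C1 = (!) us ` I" "corner I J \<inter> C2 = (!) ls ` J"
proof -
  have "(!) us ` I \<subseteq> C1" "(!) ls ` J \<subseteq> C2"
    using assms us_mem ls_mem by blast+
  then show "corner I J \<inter> C1 = (!) us ` I" "corner I J \<inter> C2 = (!) ls ` J"
    using disjoint_chains unfolding corner_def by blast+
qed

lemma (in ordered_chains) card_corner_Int:
  assumes "I \<subseteq> {..<length us}" "J \<subseteq> {..<length ls}"
  shows "card (corner I J \<inter> C1) = card I" "card (corner I J \<inter> C2) = card J"
proof -
  have "inj_on ((!) us) I" "inj_on ((!) ls) J"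
    using us(1) ls(1) assms by (auto intro!: inj_on_nth)
  then show "card (corner I J \<inter> C1) = card I" "card (corner I J \<inter> C2) = card J"
    unfolding corner_Int[OF assms] by (simp_all add: card_image)
qed

lemma (in ordered_chains) corner_star:
  assumes IJ: "cyclic_interval (length us) I" "cyclic_interval (length ls) J" "card I + card J = 4"
    and c: "c \<in> corner I J"
    and colour: "\<And>z. z \<in> corner I J \<Longrightarrow> z \<noteq> c \<Longrightarrow> (z \<in> R) \<noteq> (c \<in> R)"
    and free: "\<And>i j. i \<in> I \<Longrightarrow> j \<in> J \<Longrightarrow> c = us!i \<or> c = ls!j \<Longrightarrow> unblocked I J i j"
  shows "removable_star (C1 \<union> C2) R (corner I J) c"
proof (rule removable_starI[OF five_points _ _ c _ _ colour])
  have bounds: "I \<subseteq> {..<length us}" "J \<subseteq> {..<length ls}"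
    using IJ by (auto simp: cyclic_interval_def)
  note Int = corner_Int[OF bounds]
  show subset: "corner I J \<subseteq> C1 \<union> C2"
    using bounds us_mem ls_mem by (auto simp: corner_def)
  have diff: "C1 - corner I J = set us - (!) us ` I" "C2 - corner I J = set ls - (!) ls ` J"
    unfolding Int[symmetric] us(2) ls(2) by blast+
  show "separated (corner I J \<inter> C1) (C1 - corner I J)"
    "separated (corner I J \<inter> C2) (C2 - corner I J)"
    unfolding Int diff using separated_cyclic_interval convex_polygons IJ by blast+
  have "card (corner I J) = card (corner I J \<inter> C1) + card (corner I J \<inter> C2)"
    using subset finite_chains disjoint_chains
    by (subst card_Un_disjoint[symmetric]) (auto intro!: arg_cong[of _ _ card])
  then show "card (corner I J) = 4"
    unfolding card_corner_Int[OF bounds] using IJ(3) by simp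
  fix p q x y
  assume pq: "p \<in> corner I J \<inter> C1" "q \<in> corner I J \<inter> C2" "c = p \<or> c = q"
    and xy: "x \<in> C1 - corner I J" "y \<in> C2 - corner I J"
  obtain i j where ij: "i \<in> I" "p = us!i" "j \<in> J" "q = ls!j"
    using pq(1,2) unfolding Int by blast
  obtain k l where kl: "k < length us" "x = us!k" "l < length ls" "y = ls!l"
    using xy unfolding diff by (metis DiffD1 in_set_conv_nth)
  have "k \<notin> I" "l \<notin> J"
    using xy kl unfolding corner_def by blast+
  moreover have "unblocked I J i j"
    using ij pq(3) by (intro free) simp_all
  ultimately show "closed_segment p q \<inter> closed_segment x y = {}"
    unfolding ij kl using ij kl bounds by (intro unblocked_cross_segments_disjoint) auto
qed

lemma (in ordered_chains) corner_star_us: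
  assumes IJ: "cyclic_interval (length us) I" "cyclic_interval (length ls) J" "card I + card J = 4"
    and i: "i \<in> I" and free: "\<And>j. j \<in> J \<Longrightarrow> unblocked I J i j"
    and colour: "\<And>k. k \<in> I \<Longrightarrow> k \<noteq> i \<Longrightarrow> (us!k \<in> R) \<noteq> (us!i \<in> R)" "\<And>j. j \<in> J \<Longrightarrow> (ls!j \<in> R) \<noteq> (us!i \<in> R)"
  shows "removable_star (C1 \<union> C2) R (corner I J) (us!i)"
proof (rule corner_star[OF IJ])
  show "us!i \<in> corner I J"
    using i by (simp add: corner_def)
  show "(z \<in> R) \<noteq> (us!i \<in> R)" if "z \<in> corner I J" "z \<noteq> us!i" for z
    using that colour unfolding corner_def by blast
  show "unblocked I J k j" if "k \<in> I" "j \<in> J" "us!i = us!k \<or> us!i = ls!j" for k j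
  proof -
    have "i < length us" "k < length us" "j < length ls"
      using i that cyclic_interval_bounded IJ by blast+
    then have "k = i"
      using that(3) us_neq_ls us(1) nth_eq_iff_index_eq by blast
    then show ?thesis
      using free that(2) by blast
  qed
qed

lemma (in ordered_chains) corner_star_ls:
  assumes IJ: "cyclic_interval (length us) I" "cyclic_interval (length ls) J" "card I + card J = 4"
    and j: "j \<in> J" and free: "\<And>i. i \<in> I \<Longrightarrow> unblocked I J i j"
    and colour: "\<And>k. k \<in> J \<Longrightarrow> k \<noteq> j \<Longrightarrow> (ls!k \<in> R) \<noteq> (ls!j \<in> R)" "\<And>i. i \<in> I \<Longrightarrow> (us!i \<in> R) \<noteq> (ls!j \<in> R)"
  shows "removable_star (C1 \<union> C2) R (corner I J) (ls!j)"
proof (rule corner_star[OF IJ])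
  show "ls!j \<in> corner I J"
    using j by (simp add: corner_def)
  show "(z \<in> R) \<noteq> (ls!j \<in> R)" if "z \<in> corner I J" "z \<noteq> ls!j" for z
    using that colour unfolding corner_def by blast
  show "unblocked I J i k" if "i \<in> I" "k \<in> J" "ls!j = us!i \<or> ls!j = ls!k" for i k
  proof -
    have "j < length ls" "k < length ls" "i < length us"
      using j that cyclic_interval_bounded IJ by blast+
    then have "k = j"
      using that(3) us_neq_ls[of i j] ls(1) nth_eq_iff_index_eq by metis
    then show ?thesis
      using free that(1) by blast
  qed
qed

lemma window_count_end:
  assumes "4 \<le> length xs"
  shows "window_count 4 R xs (length xs - 2) = of_bool (xs!(length xs - 2) \<in> R) +
      of_bool (xs!(length xs - 1) \<in> R) + of_bool (xs!0 \<in> R) + of_bool (xs!1 \<in> R)"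
    and "window_count 4 R xs (length xs - 1) = of_bool (xs!(length xs - 1) \<in> R) +
      of_bool (xs!0 \<in> R) + of_bool (xs!1 \<in> R) + of_bool (xs!2 \<in> R)"
    and "window_count 4 R xs 0 = of_bool (xs!0 \<in> R) +
      of_bool (xs!1 \<in> R) + of_bool (xs!2 \<in> R) + of_bool (xs!3 \<in> R)"
proof -
  let ?m = "length xs"
  have expand: "window_count 4 R xs i = of_bool (xs ! (i mod ?m) \<in> R) +
      of_bool (xs ! ((i + 1) mod ?m) \<in> R) + of_bool (xs ! ((i + 2) mod ?m) \<in> R) +
      of_bool (xs ! ((i + 3) mod ?m) \<in> R)" for i
    unfolding window_count_def by (simp add: numeral_eq_Suc del: sum_of_bool_eq)
  have "?m - 2 + 2 = ?m" "?m - 2 + 3 = ?m + 1" "?m - 1 + 1 = ?m" "?m - 1 + 2 = ?m + 1"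
    "?m - 1 + 3 = ?m + 2" "?m - 2 + 1 = ?m - 1"
    using assms by linarith+
  then show "window_count 4 R xs (?m - 2) = of_bool (xs!(?m - 2) \<in> R) +
      of_bool (xs!(?m - 1) \<in> R) + of_bool (xs!0 \<in> R) + of_bool (xs!1 \<in> R)"
    and "window_count 4 R xs (?m - 1) = of_bool (xs!(?m - 1) \<in> R) +
      of_bool (xs!0 \<in> R) + of_bool (xs!1 \<in> R) + of_bool (xs!2 \<in> R)"
    and "window_count 4 R xs 0 = of_bool (xs!0 \<in> R) +
      of_bool (xs!1 \<in> R) + of_bool (xs!2 \<in> R) + of_bool (xs!3 \<in> R)"
    unfolding expand using assms by (simp_all only: mod_add_self1 mod_self)
      (simp_all add: numeral_2_eq_2)
qed

lemma balanced_colours_cases: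
  fixes x y a b c l :: bool
  assumes "of_bool x + of_bool y + of_bool a + of_bool b = (2::nat)"
    "of_bool y + of_bool a + of_bool b + of_bool c = (2::nat)"
  obtains "y \<noteq> a" "b \<noteq> a" "l \<noteq> a" | "a \<noteq> b" "c \<noteq> b" "l \<noteq> b" | "y \<noteq> b" "a \<noteq> b" "l \<noteq> b"
    | "b \<noteq> a" "c \<noteq> a" "l \<noteq> a" | "x \<noteq> a" "y \<noteq> a" "l \<noteq> a"
    | "a \<noteq> c" "b \<noteq> c" "l \<noteq> c" "a \<noteq> y" "b \<noteq> y" "l \<noteq> y"
  using assms by (cases x; cases y; cases a; cases b; cases c; cases l) simp_all

lemma balanced_corner:
  fixes l :: bool
  assumes m: "4 \<le> length xs" and s: "2 \<le> s" "s \<le> length xs"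
    and count: "window_count 4 R xs (length xs - 2) = 2" "window_count 4 R xs (length xs - 1) = 2"
  obtains I i where "cyclic_interval (length xs) I" "card I = 3" "i \<in> I"
    "if s \<le> i then {i..<length xs} \<subseteq> I else {..i} \<subseteq> I"
    "\<And>k. k \<in> I \<Longrightarrow> k \<noteq> i \<Longrightarrow> (xs!k \<in> R) \<noteq> (xs!i \<in> R)" "l \<noteq> (xs!i \<in> R)"
proof -
  let ?m = "length xs"
  let ?x = "xs!(?m - 2) \<in> R" and ?y = "xs!(?m - 1) \<in> R"
    and ?a = "xs!0 \<in> R" and ?b = "xs!1 \<in> R" and ?c = "xs!2 \<in> R"
  have "3 \<le> ?m"
    using m by simp
  note intervals = cyclic_interval_corners[OF this]
  have "of_bool ?x + of_bool ?y + of_bool ?a + of_bool ?b = (2::nat)"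
    "of_bool ?y + of_bool ?a + of_bool ?b + of_bool ?c = (2::nat)"
    using count unfolding window_count_end[OF m] .
  then show ?thesis
  proof (cases rule: balanced_colours_cases[of _ _ _ _ _ l])
    case 1
    then show ?thesis
      by (intro that[OF intervals(2), of 0]) (use m s in auto)
  next
    case 2
    then show ?thesis
      by (intro that[OF intervals(1), of 1]) (use m s in auto)
  next
    case 3
    then show ?thesis
      by (intro that[OF intervals(2), of 1]) (use m s in auto)
  next
    case 4
    then show ?thesis
      by (intro that[OF intervals(1), of 0]) (use m s in auto)
  next
    case 5
    then show ?thesis
      by (intro that[OF intervals(3), of 0]) (use m s in auto)
  next
    case 6
    show ?thesis
    proof (cases "s = ?m")
      case True
      then show ?thesis
        using 6 by (intro that[OF intervals(1), of 2]) (use m s in auto)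
    next
      case False
      then show ?thesis
        using 6 by (intro that[OF intervals(2), of "?m - 1"]) (use m s in auto)
    qed
  qed
qed

lemma (in ordered_chains) balanced_corner_star_us:
  assumes "4 \<le> length us" "2 \<le> s" and count: "\<And>i. i < length us \<Longrightarrow> window_count 4 R us i = 2"
  shows "\<exists>S c. removable_star (C1 \<union> C2) R S c \<and> card (S \<inter> C1) = 3 \<and> card (S \<inter> C2) = 1"
proof -
  obtain I i where I: "cyclic_interval (length us) I" "card I = 3" "i \<in> I"
    and reach: "if s \<le> i then {i..<length us} \<subseteq> I else {..i} \<subseteq> I"
    and colour: "\<And>k. k \<in> I \<Longrightarrow> k \<noteq> i \<Longrightarrow> (us!k \<in> R) \<noteq> (us!i \<in> R)" "(ls!0 \<in> R) \<noteq> (us!i \<in> R)"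
    by (rule balanced_corner[OF assms(1,2) switch(2), of R "ls!0 \<in> R"]) (use count assms(1) in auto)
  have J: "cyclic_interval (length ls) {..<1}"
    using ls(3) by (intro cyclic_interval_lessThan) (simp add: Suc_le_eq)
  have "removable_star (C1 \<union> C2) R (corner I {..<1}) (us!i)"
    using reach colour by (intro corner_star_us I J) (simp_all add: I unblocked_def)
  moreover have "card (corner I {..<1} \<inter> C1) = 3" "card (corner I {..<1} \<inter> C2) = 1"
    using card_corner_Int[of I "{..<1}"] I J by (simp_all add: cyclic_interval_def)
  ultimately show ?thesis
    by blast
qed

lemma (in ordered_chains) balanced_corner_star_ls:
  assumes "4 \<le> length ls" and count: "\<And>j. j < length ls \<Longrightarrow> window_count 4 R ls j = 2"
  shows "\<exists>S c. removable_star (C1 \<union> C2) R S c \<and> card (S \<inter> C1) = 1 \<and> card (S \<inter> C2) = 3"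
proof -
  have n: "2 \<le> length ls" "length ls \<le> length ls"
    using assms(1) by simp_all
  obtain J j where J: "cyclic_interval (length ls) J" "card J = 3" "j \<in> J"
    and reach: "if length ls \<le> j then {j..<length ls} \<subseteq> J else {..j} \<subseteq> J"
    and colour: "\<And>k. k \<in> J \<Longrightarrow> k \<noteq> j \<Longrightarrow> (ls!k \<in> R) \<noteq> (ls!j \<in> R)" "(us!0 \<in> R) \<noteq> (ls!j \<in> R)"
    by (rule balanced_corner[OF assms(1) n, of R "us!0 \<in> R"]) (use count assms(1) in auto)
  have "{..j} \<subseteq> J"
    using reach cyclic_interval_bounded[OF J(1,3)] by simp
  have I: "cyclic_interval (length us) {..<1}"
    using switch by (intro cyclic_interval_lessThan) linarith
  have "removable_star (C1 \<union> C2) R (corner {..<1} J) (ls!j)"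
    using \<open>{..j} \<subseteq> J\<close> colour switch(1) by (intro corner_star_ls I J) (simp_all add: J unblocked_def)
  moreover have "card (corner {..<1} J \<inter> C1) = 1" "card (corner {..<1} J \<inter> C2) = 3"
    using card_corner_Int[of "{..<1}" J] I J by (simp_all add: cyclic_interval_def)
  ultimately show ?thesis
    by blast
qed

section \<open>Existence of removable stars\<close>

lemma (in facing_chains) card_union_chains: "card (C1 \<union> C2) = card C1 + card C2"
  using finite_chains disjoint_chains by (rule card_Un_disjoint)

text \<open>
  With eight points the star may use up a chain, as the other four points then form a star, too.
\<close>

definition safe_star ::
  "(real^2) set \<Rightarrow> (real^2) set \<Rightarrow> (real^2) set \<Rightarrow> (real^2) set \<Rightarrow> real^2 \<Rightarrow> bool" where
  "safe_star C1 C2 R S c \<longleftrightarrow>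
     removable_star (C1 \<union> C2) R S c \<and> (C1 \<subseteq> S \<or> C2 \<subseteq> S \<longrightarrow> card (C1 \<union> C2) = 8)"

lemma safe_star_commute: "safe_star C1 C2 R S c \<longleftrightarrow> safe_star C2 C1 R S c"
  unfolding safe_star_def Un_commute[of C2 C1] by blast

lemma safe_starI:
  assumes "removable_star (C1 \<union> C2) R S c" "card (S \<inter> C1) < card C1" "card (S \<inter> C2) < card C2"
  shows "safe_star C1 C2 R S c"
proof -
  have "S \<inter> C1 \<noteq> C1" "S \<inter> C2 \<noteq> C2"
    using assms(2,3) by auto
  then show ?thesis
    using assms(1) unfolding safe_star_def by blast
qed

lemma (in facing_chains) window_safe_star:
  assumes five: "5 \<le> card (C1 \<union> C2)" and "C2 \<noteq> {}"
    and us: "distinct us" "set us = C1" "convex_polygon us"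
    and size: "4 \<le> length us" "length us = 4 \<Longrightarrow> card (C1 \<union> C2) = 8"
    and i: "i < length us" "window_count 4 R us i = 1 \<or> window_count 4 R us i = 3"
  shows "\<exists>S c. safe_star C1 C2 R S c"
proof -
  obtain S c where S: "removable_star (C1 \<union> C2) R S c" "S \<subseteq> C1"
    by (rule window_star[OF five us size(1) i])
  have "card (C1 \<union> C2) = 8" if "C1 \<subseteq> S \<or> C2 \<subseteq> S"
    using that
  proof
    assume "C1 \<subseteq> S"
    with S(2) have "S = set us"
      unfolding us(2) by (rule subset_antisym)
    then have "length us = 4"
      using S(1) distinct_card[OF us(1)] by (simp add: removable_star_def)
    then show ?thesis
      by (rule size(2))
  next
    assume "C2 \<subseteq> S"
    then show ?thesis
      using S(2) \<open>C2 \<noteq> {}\<close> disjoint_chains by blast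
  qed
  then show ?thesis
    using S(1) unfolding safe_star_def by blast
qed

lemma (in facing_chains) monochromatic_or_safe_star:
  assumes five: "5 \<le> card (C1 \<union> C2)" and even: "even (card (C1 \<union> C2))" and "C2 \<noteq> {}"
    and us: "distinct us" "set us = C1" "convex_polygon us"
    and size: "4 \<le> length us" "length us = 4 \<Longrightarrow> card (C1 \<union> C2) = 8"
    and balanced: "(\<And>i. i < length us \<Longrightarrow> window_count 4 R us i = 2) \<Longrightarrow>
      \<exists>S c. removable_star (C1 \<union> C2) R S c \<and> card (S \<inter> C1) = 3 \<and> card (S \<inter> C2) = 1"
  shows "C1 \<subseteq> R \<or> C1 \<inter> R = {} \<or> (\<exists>S c. safe_star C1 C2 R S c)"
proof (cases rule: window_count_cases[OF us(1), of R])
  case (1 i)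
  then show ?thesis
    using window_safe_star[OF five \<open>C2 \<noteq> {}\<close> us size] by blast
next
  case 2
  then show ?thesis
    unfolding us(2) by (rule disjI1)
next
  case 3
  then show ?thesis
    unfolding us(2) by (intro disjI2 disjI1)
next
  case 4
  then obtain S c where S: "removable_star (C1 \<union> C2) R S c" "card (S \<inter> C1) = 3" "card (S \<inter> C2) = 1"
    using balanced by blast
  have card_C1: "card C1 = length us"
    using distinct_card[OF us(1)] us(2) by simp
  have "even (card C2)" "card C2 \<noteq> 0"
    using even 4(2) card_C1 card_union_chains finite_chains(2) \<open>C2 \<noteq> {}\<close> by simp_all
  then have "1 < card C2"
    by (cases "card C2 = 1") auto
  then have "safe_star C1 C2 R S c"
    using S size(1) card_C1 by (intro safe_starI) simp_all
  then show ?thesis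
    by blast
qed

lemma card_monochromatic_le:
  assumes "finite X" "R \<subseteq> X" "C \<subseteq> X" "C \<subseteq> R \<or> C \<inter> R = {}"
  shows "card C \<le> max (card R) (card X - card R)"
  using assms(4)
proof
  assume "C \<subseteq> R"
  then show ?thesis
    using assms card_mono[of R C] finite_subset[of R X] by simp
next
  assume "C \<inter> R = {}"
  then have "card C \<le> card (X - R)"
    using assms by (intro card_mono) auto
  then show ?thesis
    using assms finite_subset[of R X] by (simp add: card_Diff_subset)
qed

lemma (in ordered_chains) claw_at_first_point:
  assumes "3 \<le> length ls" and colour: "\<And>j. j < 3 \<Longrightarrow> (ls!j \<in> R) \<noteq> (us!0 \<in> R)"
  shows "removable_star (C1 \<union> C2) R (corner {..<1} {..<3}) (us!0)"
proof (rule corner_star_us)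
  show "cyclic_interval (length us) {..<1}" "cyclic_interval (length ls) {..<3}"
    using assms(1) switch by (simp_all add: cyclic_interval_lessThan)
qed (use colour switch(1) in \<open>auto simp: unblocked_def\<close>)

lemma (in ordered_chains) claw_safe_star:
  assumes size: "4 \<le> length us" "4 \<le> length ls"
    and opposite: "C1 \<subseteq> R \<and> C2 \<inter> R = {} \<or> C1 \<inter> R = {} \<and> C2 \<subseteq> R"
  shows "\<exists>S c. safe_star C1 C2 R S c"
proof -
  have "(ls!j \<in> R) \<noteq> (us!0 \<in> R)" if "j < 3" for j
  proof -
    have "us!0 \<in> C1" "ls!j \<in> C2"
      using size that by (intro us_mem ls_mem; linarith)+
    then show ?thesis
      using opposite by blast
  qed
  then have "removable_star (C1 \<union> C2) R (corner {..<1} {..<3}) (us!0)"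
    using size by (intro claw_at_first_point) simp_all
  moreover have "card (corner {..<1} {..<3} \<inter> C1) = 1" "card (corner {..<1} {..<3} \<inter> C2) = 3"
    using card_corner_Int[of "{..<1}" "{..<3}"] size by simp_all
  ultimately have "safe_star C1 C2 R (corner {..<1} {..<3}) (us!0)"
    using size card_chains by (intro safe_starI) simp_all
  then show ?thesis
    by blast
qed

lemma (in ordered_chains) us_monochromatic_or_safe_star:
  assumes "even (card (C1 \<union> C2))" "4 \<le> length us" "length us = 4 \<Longrightarrow> card (C1 \<union> C2) = 8"
    and "2 \<le> s"
  shows "C1 \<subseteq> R \<or> C1 \<inter> R = {} \<or> (\<exists>S c. safe_star C1 C2 R S c)"
proof -
  have "C2 \<noteq> {}"
    using ls(2,3) by auto
  then show ?thesis
    using monochromatic_or_safe_star[OF five_points _ _ us convex_polygons(1), of R]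
      balanced_corner_star_us[of R] assms by blast
qed

lemma (in ordered_chains) ls_monochromatic_or_safe_star:
  assumes "even (card (C1 \<union> C2))" "4 \<le> length ls" "length ls = 4 \<Longrightarrow> card (C1 \<union> C2) = 8"
  shows "C2 \<subseteq> R \<or> C2 \<inter> R = {} \<or> (\<exists>S c. safe_star C1 C2 R S c)"
proof -
  have "C1 \<noteq> {}"
    using us(2) switch by auto
  then show ?thesis
    using swap.monochromatic_or_safe_star[OF _ _ _ ls(1,2) convex_polygons(2), of R]
      five_points balanced_corner_star_ls[of R] assms
    unfolding Un_commute[of C2 C1] safe_star_commute[of C2 C1] by blast
qed

lemma (in ordered_chains) ordered_safe_star_exists:
  assumes R: "R \<subseteq> C1 \<union> C2" "card (C1 \<union> C2) = 4 * (g + h)" "card R = 3 * g + h"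
    and gh: "1 \<le> g" "1 \<le> h" and s: "3 \<le> length us \<Longrightarrow> 2 \<le> s"
  shows "\<exists>S c. safe_star C1 C2 R S c"
proof (rule ccontr)
  assume none: "\<not> ?thesis"
  let ?m = "length us" and ?n = "length ls"
  have mn: "?m + ?n = 4 * (g + h)"
    using R(2) card_union_chains card_chains by simp
  define large where "large k \<longleftrightarrow> 4 \<le> k \<and> (k = 4 \<longrightarrow> g + h = 2)" for k :: nat
  have monochromatic_C1: "C1 \<subseteq> R \<or> C1 \<inter> R = {}" if "large ?m"
    using us_monochromatic_or_safe_star[of R] none that R(2) s unfolding large_def by simp
  have monochromatic_C2: "C2 \<subseteq> R \<or> C2 \<inter> R = {}" if "large ?n"
    using ls_monochromatic_or_safe_star[of R] none that R(2) unfolding large_def by simp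
  have finite: "finite (C1 \<union> C2)"
    using finite_chains by blast
  have "large ?m \<or> large ?n"
    using mn gh unfolding large_def by presburger
  moreover have "large ?n" if "large ?m"
    using card_monochromatic_le[OF finite R(1) _ monochromatic_C1[OF that]] R mn gh card_chains
    by (auto simp: large_def max_def split: if_splits)
  moreover have "large ?m" if "large ?n"
    using card_monochromatic_le[OF finite R(1) _ monochromatic_C2[OF that]] R mn gh card_chains
    by (auto simp: large_def max_def split: if_splits)
  ultimately have large: "large ?m" "large ?n"
    by blast+
  have "R \<noteq> C1 \<union> C2" "R \<noteq> {}"
    using R gh by auto
  then have "C1 \<subseteq> R \<and> C2 \<inter> R = {} \<or> C1 \<inter> R = {} \<and> C2 \<subseteq> R"
    using monochromatic_C1[OF large(1)] monochromatic_C2[OF large(2)] R(1) by blast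
  then show False
    using claw_safe_star none large unfolding large_def by blast
qed

lemma first_red:
  assumes "set xs \<inter> R \<noteq> {}" and dense: "4 \<le> length xs \<Longrightarrow> red_dense R xs"
  obtains j where "j < 3" "j < length xs" "xs!j \<in> R" "\<forall>k<j. xs!k \<notin> R"
proof -
  have "\<exists>j. j < length xs \<and> xs!j \<in> R"
    using assms(1) by (auto simp: in_set_conv_nth)
  then obtain j where j: "j < length xs" "xs!j \<in> R" "\<forall>k<j. \<not> (k < length xs \<and> xs!k \<in> R)"
    unfolding exists_least_iff[of "\<lambda>j. j < length xs \<and> xs!j \<in> R"] by blast
  then have first: "\<forall>k<j. xs!k \<notin> R"
    by (meson order.strict_trans)
  have "j < 3"
  proof (rule ccontr)
    assume "\<not> j < 3"
    then have "4 \<le> length xs" "0 < length xs" "xs!0 \<notin> R" "xs!1 \<notin> R" "xs!2 \<notin> R"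
      using j(1) first by auto
    moreover from this have "2 \<le> window_count 4 R xs 0"
      using dense unfolding red_dense_def by blast
    ultimately show False
      using window_count_end(3)[of xs R] by (simp add: of_bool_def split: if_splits)
  qed
  then show ?thesis
    by (intro that[of j] j(1,2) first)
qed

lemma card_le_if_prefix_disjoint:
  assumes "R \<subseteq> set xs" "\<forall>k<i. xs!k \<notin> R"
  shows "card R \<le> length xs - i"
proof -
  have "R \<subseteq> (!) xs ` {i..<length xs}"
  proof
    fix x assume "x \<in> R"
    then obtain k where k: "k < length xs" "xs!k = x"
      using assms(1) unfolding in_set_conv_nth[symmetric] by (meson in_set_conv_nth subsetD)
    then have "i \<le> k"
      using assms(2) \<open>x \<in> R\<close> by (meson not_le)
    then show "x \<in> (!) xs ` {i..<length xs}"
      using k by auto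
  qed
  then show ?thesis
    using surj_card_le[of "{i..<length xs}" R "(!) xs"] by simp
qed

lemma last_red_if_window_count_ge_2:
  assumes "4 \<le> length xs" "2 \<le> window_count 4 R xs (length xs - 1)" "xs!0 \<notin> R" "xs!1 \<notin> R"
  shows "xs!(length xs - 1) \<in> R"
  using assms window_count_end(2)[OF assms(1), of R] by (simp add: of_bool_def split: if_splits)

lemma (in ordered_chains) red_centred_star_ls:
  assumes blue: "C1 \<inter> R = {}" and size: "4 \<le> length us" "2 \<le> s"
    and j: "j < 3" "j < length ls" "ls!j \<in> R" "\<forall>k<j. ls!k \<notin> R"
  shows "\<exists>S. removable_star (C1 \<union> C2) R S (ls!j)"
proof -
  let ?m = "length us"
  have blue_us: "us!i \<notin> R" if "i < ?m" for i
    using blue us_mem[OF that] by blast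
  have J: "cyclic_interval (length ls) {..<Suc j}"
    using j(2) by (intro cyclic_interval_lessThan) simp
  show ?thesis
  proof (cases "j = 0 \<and> s < ?m")
    case True
    have "cyclic_interval ?m {?m - 1, 0, 1}"
      using size by (intro cyclic_interval_corners) simp
    moreover have "us!0 \<notin> R" "us!1 \<notin> R" "us!(?m - 1) \<notin> R"
      using size(1) by (intro blue_us; linarith)+
    ultimately have "removable_star (C1 \<union> C2) R (corner {?m - 1, 0, 1} {..<Suc j}) (ls!j)"
      using True size j J by (intro corner_star_ls) (auto simp: unblocked_def card_insert_if)
    then show ?thesis
      by blast
  next
    case False
    have "cyclic_interval ?m {..<3 - j}"
      using size by (intro cyclic_interval_lessThan) simp
    then have "removable_star (C1 \<union> C2) R (corner {..<3 - j} {..<Suc j}) (ls!j)"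
      using False size j J blue_us switch by (intro corner_star_ls) (auto simp: unblocked_def)
    then show ?thesis
      by blast
  qed
qed

lemma (in ordered_chains) red_centred_star_us:
  assumes blue: "C2 \<inter> R = {}" and size: "4 \<le> length ls"
    and i: "i < 3" "i < s" "us!i \<in> R" "\<forall>k<i. us!k \<notin> R"
  shows "removable_star (C1 \<union> C2) R (corner {..<Suc i} {..<3 - i}) (us!i)"
proof (rule corner_star_us)
  show "cyclic_interval (length us) {..<Suc i}" "cyclic_interval (length ls) {..<3 - i}"
    using i switch size by (simp_all add: cyclic_interval_lessThan)
  have "ls!j \<notin> R" if "j < length ls" for j
    using blue ls_mem[OF that] by blast
  then show "(ls!j \<in> R) \<noteq> (us!i \<in> R)" if "j \<in> {..<3 - i}" for j
    using that i size by simp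
qed (use i in \<open>auto simp: unblocked_def\<close>)

lemma (in ordered_chains) red_centred_star_us_last:
  assumes blue: "C2 \<inter> R = {}" and size: "3 \<le> length us" "s < length us"
    and colours: "us!(length us - 1) \<in> R" "us!0 \<notin> R" "us!1 \<notin> R"
  shows "removable_star (C1 \<union> C2) R (corner {length us - 1, 0, 1} {..<1}) (us!(length us - 1))"
proof (rule corner_star_us)
  show "cyclic_interval (length us) {length us - 1, 0, 1}" "cyclic_interval (length ls) {..<1}"
    using size ls(3) by (simp_all only: cyclic_interval_corners)
      (simp add: cyclic_interval_lessThan Suc_le_eq)
  show "(ls!j \<in> R) \<noteq> (us!(length us - 1) \<in> R)" if "j \<in> {..<1}" for j
    using that blue ls_mem[of 0] ls(3) colours(1) by auto
qed (use size colours in \<open>auto simp: unblocked_def card_insert_if\<close>)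

lemma (in ordered_chains) red_centred_star_exists_if_us_blue:
  assumes R: "R \<subseteq> C1 \<union> C2" "card (C1 \<union> C2) = 4 * card R" "2 \<le> card R" and s: "3 \<le> length us \<Longrightarrow> 2 \<le> s"
    and blue: "C1 \<inter> R = {}"
    and dense: "4 \<le> length ls \<Longrightarrow> red_dense R ls"
  shows "\<exists>S c. removable_star (C1 \<union> C2) R S c \<and> c \<in> R"
proof -
  have red: "C2 \<inter> R = R"
    using R(1) blue by blast
  have size: "4 \<le> length us"
    using R(2,3) dense card_union_chains card_chains unfolding red_dense_def ls(2) red by linarith
  have "2 \<le> s"
    using s size by simp
  have "set ls \<inter> R \<noteq> {}"
    unfolding ls(2) red using R(3) by auto
  then obtain j where j: "j < 3" "j < length ls" "ls!j \<in> R" "\<forall>k<j. ls!k \<notin> R"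
    using dense by (rule first_red)
  then show ?thesis
    using red_centred_star_ls[OF blue size \<open>2 \<le> s\<close> j] by blast
qed

lemma (in ordered_chains) red_centred_star_exists_if_ls_blue:
  assumes R: "R \<subseteq> C1 \<union> C2" "card (C1 \<union> C2) = 4 * card R" "2 \<le> card R" and s: "3 \<le> length us \<Longrightarrow> 2 \<le> s"
    and blue: "C2 \<inter> R = {}"
    and dense: "4 \<le> length us \<Longrightarrow> red_dense R us"
  shows "\<exists>S c. removable_star (C1 \<union> C2) R S c \<and> c \<in> R"
proof -
  let ?m = "length us"
  have red: "C1 \<inter> R = R"
    using R(1) blue by blast
  have size: "4 \<le> length ls"
    using R(2,3) dense card_union_chains card_chains unfolding red_dense_def us(2) red by linarith
  have "set us \<inter> R \<noteq> {}"
    unfolding us(2) red using R(3) by auto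
  then obtain i where i: "i < 3" "i < ?m" "us!i \<in> R" "\<forall>k<i. us!k \<notin> R"
    using dense by (rule first_red)
  show ?thesis
  proof (cases "i < s")
    case True
    then show ?thesis
      using red_centred_star_us[OF blue size i(1) True i(3,4)] i(3) by blast
  next
    case False
    have "R \<subseteq> set us"
      unfolding us(2) using red by blast
    then have "card R \<le> ?m - i"
      using i(4) by (rule card_le_if_prefix_disjoint)
    then have "2 \<le> s" "i = 2" "4 \<le> ?m"
      using R(3) s switch(1) i(1) False by linarith+
    have blue_start: "us!0 \<notin> R" "us!1 \<notin> R"
      using i(4) \<open>i = 2\<close> by simp_all
    have "2 \<le> window_count 4 R us (?m - 1)"
      using dense \<open>4 \<le> ?m\<close> by (simp add: red_dense_def)
    then have "us!(?m - 1) \<in> R"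
      using \<open>4 \<le> ?m\<close> blue_start by (intro last_red_if_window_count_ge_2)
    moreover have "3 \<le> ?m" "s < ?m"
      using \<open>4 \<le> ?m\<close> \<open>i = 2\<close> False by linarith+
    ultimately show ?thesis
      using red_centred_star_us_last[OF blue] blue_start by blast
  qed
qed

lemma (in facing_chains) red_dense_or_red_centred_star:
  assumes "5 \<le> card (C1 \<union> C2)" "distinct us" "set us = C1" "convex_polygon us" "4 \<le> length us"
  shows "(\<exists>S c. removable_star (C1 \<union> C2) R S c \<and> c \<in> R) \<or> C1 \<inter> R = {} \<or>
    red_dense R us"
proof (cases "\<exists>i<length us. window_count 4 R us i = 1")
  case True
  then show ?thesis
    using window_star[OF assms] by metis
next
  case False
  then show ?thesis
    using disjoint_or_red_dense[OF assms(2), of R] assms(3) by blast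
qed

lemma (in ordered_chains) ordered_red_centred_star_exists:
  assumes R: "R \<subseteq> C1 \<union> C2" "card (C1 \<union> C2) = 4 * card R" "2 \<le> card R" and s: "3 \<le> length us \<Longrightarrow> 2 \<le> s"
  shows "\<exists>S c. removable_star (C1 \<union> C2) R S c \<and> c \<in> R"
proof (rule ccontr)
  assume none: "\<not> ?thesis"
  have dense_us: "C1 \<inter> R = {} \<or> red_dense R us"
    if "4 \<le> length us"
    using red_dense_or_red_centred_star[OF five_points us convex_polygons(1) that] none by blast
  have "5 \<le> card (C2 \<union> C1)"
    using five_points by (simp add: Un_commute)
  then have dense_ls: "C2 \<inter> R = {} \<or> red_dense R ls"
    if "4 \<le> length ls"
    using swap.red_dense_or_red_centred_star[OF _ ls(1,2) convex_polygons(2) that] none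
    unfolding Un_commute[of C2 C1] by blast
  have "R = (C1 \<inter> R) \<union> (C2 \<inter> R)"
    using R(1) by blast
  then have reds: "card R = card (C1 \<inter> R) + card (C2 \<inter> R)"
    using finite_chains disjoint_chains
    by (metis Int_assoc card_Un_disjoint finite_Int inf_bot_left inf_left_commute)
  have "C1 \<inter> R = {} \<or> C2 \<inter> R = {}"
  proof (rule ccontr)
    assume "\<not> ?thesis"
    moreover from this have "card (C1 \<inter> R) \<noteq> 0" "card (C2 \<inter> R) \<noteq> 0"
      using finite_chains by simp_all
    ultimately show False
      using dense_us dense_ls reds R(2,3) card_union_chains card_chains
      unfolding red_dense_def us(2) ls(2) by linarith
  qed
  then show False
  proof
    assume "C1 \<inter> R = {}"
    then have "C2 \<inter> R \<noteq> {}"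
      using reds R(3) by auto
    then have "red_dense R ls" if "4 \<le> length ls"
      using dense_ls that by blast
    then show False
      using red_centred_star_exists_if_us_blue[OF R s \<open>C1 \<inter> R = {}\<close>] none by blast
  next
    assume "C2 \<inter> R = {}"
    then have "C1 \<inter> R \<noteq> {}"
      using reds R(3) by auto
    then have "red_dense R us" if "4 \<le> length us"
      using dense_us that by blast
    then show False
      using red_centred_star_exists_if_ls_blue[OF R s \<open>C2 \<inter> R = {}\<close>] none by blast
  qed
qed

lemma (in facing_chains) red_centred_star_exists_if_empty:
  assumes "C2 = {}" and R: "R \<subseteq> C1" "card C1 = 4 * card R" "2 \<le> card R"
  shows "\<exists>S c. removable_star (C1 \<union> C2) R S c \<and> c \<in> R"
proof -
  obtain us where us: "distinct us" "set us = C1" "convex_polygon us"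
    using convex_position_convex_polygon[OF finite_chains(1) _ convex_chains(1)] general_chains
      \<open>C2 = {}\<close> by auto
  have "length us = 4 * card R"
    using distinct_card[OF us(1)] us(2) R(2) by simp
  moreover have "C1 \<inter> R = R" "R \<noteq> {}"
    using R(1,3) by auto
  moreover have "5 \<le> card (C1 \<union> C2)"
    using R(2,3) \<open>C2 = {}\<close> by simp
  ultimately show ?thesis
    using red_dense_or_red_centred_star[OF _ us, of R] us(2) R(3) by (auto simp: red_dense_def)
qed

lemma (in facing_chains) red_centred_star_exists:
  assumes R: "R \<subseteq> C1 \<union> C2" "card (C1 \<union> C2) = 4 * card R" "2 \<le> card R"
  shows "\<exists>S c. removable_star (C1 \<union> C2) R S c \<and> c \<in> R"
proof -
  consider "C2 = {}" | "C1 = {}" | "C1 \<noteq> {}" "C2 \<noteq> {}"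
    by blast
  then show ?thesis
  proof cases
    case 1
    then show ?thesis
      using red_centred_star_exists_if_empty R by simp
  next
    case 2
    then show ?thesis
      using swap.red_centred_star_exists_if_empty R by simp
  next
    case 3
    have "5 \<le> card (C1 \<union> C2)"
      using R(2,3) by simp
    then obtain D1 D2 \<sigma> us ls s where D: "(D1, D2) = (C1, C2) \<or> (D1, D2) = (C2, C1)"
      and ordered: "ordered_chains D1 D2 \<sigma> us ls s" and s: "3 \<le> length us \<Longrightarrow> 2 \<le> s"
      using ordered_chains_exist 3 by blast
    have X: "D1 \<union> D2 = C1 \<union> C2"
      using D by auto
    interpret D: ordered_chains D1 D2 \<sigma> us ls s by (fact ordered)
    show ?thesis
      using D.ordered_red_centred_star_exists[of R] R s unfolding X by blast
  qed
qed

lemma (in facing_chains) safe_star_exists: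
  assumes ne: "C1 \<noteq> {}" "C2 \<noteq> {}"
    and R: "R \<subseteq> C1 \<union> C2" "card (C1 \<union> C2) = 4 * (g + h)" "card R = 3 * g + h" and gh: "1 \<le> g" "1 \<le> h"
  shows "\<exists>S c. safe_star C1 C2 R S c"
proof -
  have "5 \<le> card (C1 \<union> C2)"
    using R(2) gh by simp
  then obtain D1 D2 \<sigma> us ls s where D: "(D1, D2) = (C1, C2) \<or> (D1, D2) = (C2, C1)"
    and ordered: "ordered_chains D1 D2 \<sigma> us ls s" and s: "3 \<le> length us \<Longrightarrow> 2 \<le> s"
    using ordered_chains_exist ne by blast
  have X: "D1 \<union> D2 = C1 \<union> C2"
    using D by auto
  interpret D: ordered_chains D1 D2 \<sigma> us ls s by (fact ordered)
  have "\<exists>S c. safe_star D1 D2 R S c"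
    using D.ordered_safe_star_exists[of R g h] R gh s unfolding X by blast
  then show ?thesis
    using D by (metis Pair_inject safe_star_commute)
qed

section \<open>The induction\<close>

lemma removable_star_complement:
  assumes "R \<inter> B = {}" "removable_star (R \<union> B) B S c"
  shows "removable_star (R \<union> B) R S c"
proof -
  have "z \<in> R \<longleftrightarrow> z \<notin> B" if "z \<in> R \<union> B" for z
    using that assms(1) by blast
  then show ?thesis
    using assms(2) unfolding removable_star_def by (meson DiffD1 subsetD)
qed

lemma removable_star_whole:
  assumes "R \<inter> B = {}" "R = {c}" "card B = 3"
  shows "removable_star (R \<union> B) R (R \<union> B) c"
  using assms by (auto simp: removable_star_def unobstructed_def card_ge_0_finite)

lemma removable_star_four_points:
  assumes "R \<inter> B = {}" and cards: "card R = 1 \<and> card B = 3 \<or> card R = 3 \<and> card B = 1"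
  obtains c where "removable_star (R \<union> B) R (R \<union> B) c" "c \<in> R \<longleftrightarrow> card R = 1"
  using cards
proof
  assume one_red: "card R = 1 \<and> card B = 3"
  then obtain c where "R = {c}"
    by (auto simp: card_1_singleton_iff)
  then show ?thesis
    using removable_star_whole[OF assms(1)] one_red by (intro that[of c]) auto
next
  assume one_blue: "card R = 3 \<and> card B = 1"
  then obtain c where "B = {c}"
    by (auto simp: card_1_singleton_iff)
  moreover from this have "removable_star (R \<union> B) B (R \<union> B) c"
    using removable_star_whole[of B R c] assms(1) one_blue by (simp add: Un_commute Int_commute)
  ultimately show ?thesis
    using removable_star_complement[OF assms(1)] assms(1) one_blue by (intro that[of c]) auto
qed

lemma removable_star_centre_red:
  assumes "R \<inter> B = {}" "removable_star (R \<union> B) R S c" "c \<in> R"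
  shows "R \<inter> S = {c}" "B \<inter> S = S - {c}"
  using assms unfolding removable_star_def by blast+

lemma removable_star_centre_blue:
  assumes "R \<inter> B = {}" "removable_star (R \<union> B) R S c" "c \<in> B"
  shows "R \<inter> S = S - {c}" "B \<inter> S = {c}"
  using assms unfolding removable_star_def by blast+

lemma card_removable_star:
  assumes "finite R" "finite B" "R \<inter> B = {}" "removable_star (R \<union> B) R S c"
  shows "c \<in> R \<Longrightarrow> card R = card (R - S) + 1 \<and> card B = card (B - S) + 3"
    and "c \<in> B \<Longrightarrow> card R = card (R - S) + 3 \<and> card B = card (B - S) + 1"
proof -
  have leaves: "card (S - {c}) = 3"
    using assms(4) by (simp add: removable_star_def)
  have split: "card R = card (R \<inter> S) + card (R - S)" "card B = card (B \<inter> S) + card (B - S)"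
    using assms(1,2) by (simp_all add: card_Int_Diff)
  show "card R = card (R - S) + 1 \<and> card B = card (B - S) + 3" if "c \<in> R"
    using split leaves unfolding removable_star_centre_red[OF assms(3,4) that] by simp
  show "card R = card (R - S) + 3 \<and> card B = card (B - S) + 1" if "c \<in> B"
    using split leaves unfolding removable_star_centre_blue[OF assms(3,4) that] by simp
qed

lemma noncrossing_if_orient_neq_0:
  assumes "orient c x y \<noteq> 0"
  shows "noncrossing (c, x) (c, y)"
proof -
  have "z = c" if z: "z \<in> closed_segment c x" "z \<in> closed_segment c y" for z
  proof -
    obtain u where "z = (1 - u) *\<^sub>R c + u *\<^sub>R x"
      using z(1) by (auto simp: in_segment)
    then have "orient c x z = 0"
      by (simp add: orient_convex_comb)
    moreover obtain v where v: "z = (1 - v) *\<^sub>R c + v *\<^sub>R y"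
      using z(2) by (auto simp: in_segment)
    then have "orient c x z = v * orient c x y"
      by (simp add: orient_convex_comb)
    ultimately show ?thesis
      using assms v by simp
  qed
  then show ?thesis
    unfolding noncrossing_def by auto
qed

lemma noncrossing_if_disjoint:
  assumes "closed_segment (fst e) (snd e) \<inter> closed_segment (fst f) (snd f) = {}"
  shows "noncrossing e f" "noncrossing f e"
  using assms unfolding noncrossing_def by auto

lemma star_edges_insert:
  assumes "S \<notin> P"
  shows "star_edges (insert S P) (ctr(S := c)) = star_edges P ctr \<union> {c} \<times> (S - {c})"
  using assms unfolding star_edges_def by auto

lemma pairwise_noncrossing_insert_star:
  assumes gp: "general_position X" and S: "S \<subseteq> X" "c \<in> S" "S \<notin> P" and union: "\<Union>P = X - S"
    and rest: "pairwise noncrossing (star_edges P ctr)" and centres: "\<And>T. T \<in> P \<Longrightarrow> ctr T \<in> T"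
    and free: "\<And>z. z \<in> S - {c} \<Longrightarrow> unobstructed (X - S) c z"
  shows "pairwise noncrossing (star_edges (insert S P) (ctr(S := c)))"
proof -
  have in_rest: "fst e \<in> X - S" "snd e \<in> X - S" if "e \<in> star_edges P ctr" for e
    using that centres unfolding star_edges_def union[symmetric] by fastforce+
  have "noncrossing (c, x) e" "noncrossing e (c, x)" if "x \<in> S - {c}" "e \<in> star_edges P ctr" for x e
  proof -
    have "closed_segment (fst (c, x)) (snd (c, x)) \<inter> closed_segment (fst e) (snd e) = {}"
      using free[OF that(1)] in_rest[OF that(2)] unfolding unobstructed_def by simp
    then show "noncrossing (c, x) e" "noncrossing e (c, x)"
      by (rule noncrossing_if_disjoint)+
  qed
  moreover have "noncrossing (c, x) (c, y)" if "x \<in> S - {c}" "y \<in> S - {c}" "x \<noteq> y" for x y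
    using that S(1,2) by (intro noncrossing_if_orient_neq_0 general_position_orient[OF gp]) auto
  ultimately show ?thesis
    using rest unfolding star_edges_insert[OF S(3)] pairwise_def by blast
qed

lemma K13_coverable_if_removable_star:
  assumes gp: "general_position (R \<union> B)" and RB: "R \<inter> B = {}"
    and star: "removable_star (R \<union> B) R S c"
    and rest: "K13_coverable (R - S) (B - S)"
  shows "K13_coverable R B"
proof -
  obtain P ctr where P: "partition_on (R \<union> B - S) P" "pairwise noncrossing (star_edges P ctr)"
    and blocks: "\<And>T. T \<in> P \<Longrightarrow> card T = 4 \<and> ctr T \<in> T \<and>
       (ctr T \<in> R - S \<and> T - {ctr T} \<subseteq> B - S \<or> ctr T \<in> B - S \<and> T - {ctr T} \<subseteq> R - S)"
    using rest unfolding K13_coverable_def Un_Diff[symmetric] by blast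
  have S: "S \<subseteq> R \<union> B" "c \<in> S" "card S = 4"
    and free: "\<And>z. z \<in> S - {c} \<Longrightarrow> unobstructed (R \<union> B - S) c z"
    and colour: "\<And>z. z \<in> S - {c} \<Longrightarrow> (z \<in> R) \<noteq> (c \<in> R)"
    using star unfolding removable_star_def by blast+
  have union: "\<Union>P = R \<union> B - S"
    using P(1) by (simp add: partition_on_def)
  then have "S \<notin> P"
    using S(2) by blast
  let ?P = "insert S P" and ?ctr = "ctr(S := c)"
  have "partition_on (R \<union> B) ?P"
    using partition_on_insert[of S P "R \<union> B"] P(1) S(1,2) union by (auto simp: disjnt_def)
  moreover have "card T = 4 \<and> ?ctr T \<in> T \<and>
      (?ctr T \<in> R \<and> T - {?ctr T} \<subseteq> B \<or> ?ctr T \<in> B \<and> T - {?ctr T} \<subseteq> R)" if "T \<in> ?P" for T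
  proof (cases "T = S")
    case True
    have "c \<in> R \<and> S - {c} \<subseteq> B \<or> c \<in> B \<and> S - {c} \<subseteq> R"
      using S(1,2) colour by blast
    then show ?thesis
      using True S by simp
  next
    case False
    then show ?thesis
      using blocks[of T] that by auto
  qed
  moreover have "pairwise noncrossing (star_edges ?P ?ctr)"
    using blocks free
    by (intro pairwise_noncrossing_insert_star[OF gp S(1,2) \<open>S \<notin> P\<close> union P(2)]) auto
  ultimately show ?thesis
    unfolding K13_coverable_def by blast
qed

lemma K13_coverable_empty: "K13_coverable {} {}"
  unfolding K13_coverable_def
  by (intro exI[of _ "{}"] exI[of _ id]) (simp add: partition_on_empty star_edges_def)

lemma (in facing_chains) removable_star_exists:
  assumes X: "R \<union> B = C1 \<union> C2" "R \<inter> B = {}" and cards: "card R = 3 * g + h" "card B = g + 3 * h"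
    and "g + h \<noteq> 0" and inv: "C1 \<noteq> {} \<and> C2 \<noteq> {} \<or> g = 0 \<or> h = 0"
  obtains S c where "removable_star (R \<union> B) R S c"
    "c \<in> R \<longrightarrow> 1 \<le> h \<and> (C1 - S \<noteq> {} \<and> C2 - S \<noteq> {} \<or> g = 0 \<or> h = 1)"
    "c \<in> B \<longrightarrow> 1 \<le> g \<and> (C1 - S \<noteq> {} \<and> C2 - S \<noteq> {} \<or> g = 1 \<or> h = 0)"
proof -
  have "finite (R \<union> B)"
    using finite_chains X(1) by simp
  then have card_X: "card (R \<union> B) = 4 * (g + h)"
    using cards X(2) by (simp add: card_Un_disjoint)
  consider "g = 0 \<and> h = 1 \<or> g = 1 \<and> h = 0" | "g = 0" "2 \<le> h" | "2 \<le> g" "h = 0" | "1 \<le> g" "1 \<le> h"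
    using \<open>g + h \<noteq> 0\<close> by linarith
  then show ?thesis
  proof cases
    case 1
    then have "card R = 1 \<and> card B = 3 \<or> card R = 3 \<and> card B = 1"
      using cards by auto
    then obtain c where "removable_star (R \<union> B) R (R \<union> B) c" "c \<in> R \<longleftrightarrow> card R = 1"
      by (rule removable_star_four_points[OF X(2)])
    then show ?thesis
      using 1 cards X(2) by (intro that[of "R \<union> B" c]) auto
  next
    case 2
    then obtain S c where "removable_star (R \<union> B) R S c" "c \<in> R"
      using red_centred_star_exists[of R] card_X cards X(1) by auto
    then show ?thesis
      using 2 X(2) by (intro that[of S c]) auto
  next
    case 3
    then obtain S c where "removable_star (R \<union> B) B S c" "c \<in> B"
      using red_centred_star_exists[of B] card_X cards X(1) by auto
    then show ?thesis
      using removable_star_complement[OF X(2)] 3 X(2) by (intro that[of S c]) auto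
  next
    case 4
    then obtain S c where "safe_star C1 C2 R S c"
      using safe_star_exists[of R g h] inv card_X cards(1) X(1) by auto
    then show ?thesis
      using 4 card_X unfolding safe_star_def X(1)[symmetric] by (intro that[of S c]) auto
  qed
qed

lemma (in facing_chains) reducing_star_exists:
  assumes X: "R \<union> B = C1 \<union> C2" "R \<inter> B = {}"
    and cards: "card R = 3 * g + h" "card B = g + 3 * h"
    and "g + h \<noteq> 0" and inv: "C1 \<noteq> {} \<and> C2 \<noteq> {} \<or> g = 0 \<or> h = 0"
  obtains S c g' h' where "removable_star (R \<union> B) R S c" "g + h = Suc (g' + h')"
    "card (R - S) = 3 * g' + h'" "card (B - S) = g' + 3 * h'"
    "C1 - S \<noteq> {} \<and> C2 - S \<noteq> {} \<or> g' = 0 \<or> h' = 0"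
proof -
  have finite: "finite R" "finite B"
    using finite_chains X(1) by (metis finite_Un)+
  obtain S c where star: "removable_star (R \<union> B) R S c"
    and red: "c \<in> R \<longrightarrow> 1 \<le> h \<and> (C1 - S \<noteq> {} \<and> C2 - S \<noteq> {} \<or> g = 0 \<or> h = 1)"
    and blue: "c \<in> B \<longrightarrow> 1 \<le> g \<and> (C1 - S \<noteq> {} \<and> C2 - S \<noteq> {} \<or> g = 1 \<or> h = 0)"
    using removable_star_exists[OF assms] by blast
  note counts = card_removable_star[OF finite X(2) star]
  have "c \<in> R \<or> c \<in> B"
    using star by (auto simp: removable_star_def)
  then show ?thesis
  proof
    assume "c \<in> R"
    then show ?thesis
      using counts(1) cards red by (intro that[OF star, of g "h - 1"]) auto
  next
    assume "c \<in> B"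
    then show ?thesis
      using counts(2) cards blue by (intro that[OF star, of "g - 1" h]) auto
  qed
qed

lemma facing_chains_K13_coverable:
  assumes "facing_chains C1 C2" "R \<union> B = C1 \<union> C2" "R \<inter> B = {}"
    "card R = 3 * g + h" "card B = g + 3 * h" "C1 \<noteq> {} \<and> C2 \<noteq> {} \<or> g = 0 \<or> h = 0"
  shows "K13_coverable R B"
  using assms
proof (induction "g + h" arbitrary: g h C1 C2 R B)
  case 0
  interpret facing_chains C1 C2 by (fact 0)
  have "finite R" "finite B"
    using finite_chains 0(3) by (metis finite_Un)+
  then have "R = {}" "B = {}"
    using 0(1,5,6) by simp_all
  then show ?case
    using K13_coverable_empty by simp
next
  case (Suc N)
  interpret facing_chains C1 C2 by (fact Suc.prems)
  note X = Suc.prems(2,3)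
  have "g + h \<noteq> 0"
    using Suc.hyps(2) by linarith
  then obtain S c g' h' where star: "removable_star (R \<union> B) R S c" and "g + h = Suc (g' + h')"
    and rest: "card (R - S) = 3 * g' + h'" "card (B - S) = g' + 3 * h'"
      "C1 - S \<noteq> {} \<and> C2 - S \<noteq> {} \<or> g' = 0 \<or> h' = 0"
    using reducing_star_exists[OF X Suc.prems(4,5) _ Suc.prems(6)] by blast
  have "facing_chains (C1 - S) (C2 - S)"
    by (rule facing_subchains) auto
  moreover have "(R - S) \<union> (B - S) = (C1 - S) \<union> (C2 - S)" "(R - S) \<inter> (B - S) = {}"
    using X by auto
  moreover have "N = g' + h'"
    using Suc.hyps(2) \<open>g + h = _\<close> by simp
  ultimately have "K13_coverable (R - S) (B - S)"
    using Suc.hyps(1)[of g' h' "C1 - S" "C2 - S"] rest by blast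
  then show ?case
    using K13_coverable_if_removable_star[OF _ X(2) star] general_chains X(1) by simp
qed

theorem theorem11:
  fixes g h :: nat and R B :: "(real^2) set"
  assumes "finite R" and "finite B" and "R \<inter> B = {}"
    and "card R = 3 * g + h" and "card B = g + 3 * h"
    and "double_chain (R \<union> B)"
    and "general_position (R \<union> B)"
  shows "K13_coverable R B"
proof -
  obtain C1 C2 where C: "R \<union> B = C1 \<union> C2" "C1 \<inter> C2 = {}" "C1 \<noteq> {}" "C2 \<noteq> {}"
      "convex_position C1" "convex_position C2"
      "\<forall>p\<in>C1. \<forall>q\<in>C2. closed_segment p q \<inter> convex hull C1 = {p} \<and>
          closed_segment p q \<inter> convex hull C2 = {q}"
    using assms(6) unfolding double_chain_def by blast
  have "finite (C1 \<union> C2)"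
    using assms(1,2) C(1) by (metis finite_UnI)
  then have "facing_chains C1 C2"
    using C assms(7) by unfold_locales auto
  then show ?thesis
    using facing_chains_K13_coverable[OF _ C(1) assms(3-5)] C(3,4) by blast
qed

end
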